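(* Let $n\ge 2$ be an integer, $t_1,t_2,\ldots,t_n\in\mathbb{R}$, $r\in\mathbb{R}$, and set $s:=r-\frac{1}{n-1}$. Assume that among the numbers $(t_i-t_j)/\pi$, $1\le i,j\le n$, one can extract $n-1$ elements $\tau_1,\ldots,\tau_{n-1}$ that belong to a real algebraic extension of $\mathbb{Q}$ of degree $n$ and such that $1,\tau_1,\ldots,\tau_{n-1}$ are linearly independent over $\mathbb{Q}$. Then there exists a constant $c>0$ such that $$\|y_0\|_s+\|y_1\|_{s-1}\le c\,(\|y(t_1)\|_r+\cdots+\|y(t_n)\|_r)$$ for all initial data $(y_0,y_1)\in D^r\times D^{r-1}$, where $y$ is the solution of the classical vibrating string problem with initial data $(y_0,y_1)$.
   Context: Function spaces: let $D$ be the vector space of finite linear combinations $\sum_k c_k\sin(kx)$, $c_k\in\mathbb{C}$, $k=1,2,\ldots$, on $(0,\pi)$. For $s\in\mathbb{R}$, equip $D$ with the norm $\|\sum_k c_k\sin(kx)\|_s^2:=\sum_k k^{2s}|c_k|^2$, and let $D^s$ be the completion of $D$ for $\|\cdot\|_s$. Classical string: the problem $y''-y_{xx}=0$ in $\mathbb{R}\times(0,\pi)$, $y=0$ on $\mathbb{R}\times\{0,\pi\}$, $y(0)=y_0$, $y'(0)=y_1$ in $(0,\pi)$ (prime denotes the time derivative, $y(t)$ denotes $y(t,\cdot)$). For $\sigma\in\mathbb{R}$, $y_0\in D^\sigma$, $y_1\in D^{\sigma-1}$, its unique solution in $C(\mathbb{R},D^\sigma)\cap C^1(\mathbb{R},D^{\sigma-1})\cap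 C^2(\mathbb{R},D^{\sigma-2})$ is $y(t,x)=\sum_{k\ge1}(a_ke^{ikt}+b_ke^{-ikt})\sin kx$, where the complex numbers $a_k,b_k$ are determined by the initial data: $y_0=\sum_k(a_k+b_k)\sin kx$, $y_1=\sum_k ik(a_k-b_k)\sin kx$. A real algebraic extension of $\mathbb{Q}$ of degree $n$ is a field $K$ with $\mathbb{Q}\subset K\subset\mathbb{R}$ and $[K:\mathbb{Q}]=n$. *)

theory Defs
  imports "HOL-Analysis.Analysis"
begin

section \<open>The spaces \<open>D\<^sup>s\<close> of sine series\<close>

text \<open>
  A formal sine series \<open>\<Sum>k\<ge>1. c k * sin (k x)\<close> is represented by its coefficient sequence,
  with the convention \<open>c 0 = 0\<close>, so that equality of series is equality of functions.
  The finite sums (the space \<open>D\<close>) are the finitely supported sequences; this loses nothing because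
  the coefficients are determined by the values on the open interval \<open>(0, \<pi>)\<close>
  (\<open>sine_coeffs_unique\<close> below). For negative \<open>s\<close> the elements of \<open>D\<^sup>s\<close> are not functions
  of \<open>x\<close> in general. All \<open>D\<^sup>s\<close> are realised inside the same space of sequences, so that
  the usual inclusions between them are literal.
\<close>

definition sine_poly :: "(nat \<Rightarrow> complex) set" where
  "sine_poly = {c. c 0 = 0 \<and> finite {k. c k \<noteq> 0}}"

definition Dnorm :: "real \<Rightarrow> (nat \<Rightarrow> complex) \<Rightarrow> real" where
  "Dnorm s c = sqrt (\<Sum>\<^sub>\<infinity>k\<in>{1..}. real k powr (2 * s) * (cmod (c k))\<^sup>2)"

text \<open>
  \<open>D s\<close> is the completion of \<open>sine_poly\<close> for \<open>Dnorm s\<close>: it is complete (\<open>D_complete\<close>) and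
  contains \<open>sine_poly\<close> as a dense subspace (\<open>sine_poly_subset_D\<close>, \<open>sine_poly_dense\<close>).
\<close>

definition D :: "real \<Rightarrow> (nat \<Rightarrow> complex) set" where
  "D s = {c. c 0 = 0 \<and> (\<lambda>k. real k powr (2 * s) * (cmod (c k))\<^sup>2) summable_on {1..}}"


section \<open>The vibrating string\<close>

definition D_continuous :: "real \<Rightarrow> (real \<Rightarrow> nat \<Rightarrow> complex) \<Rightarrow> bool" where
  "D_continuous s y \<longleftrightarrow>
     (\<forall>t. y t \<in> D s) \<and> (\<forall>t. ((\<lambda>u. Dnorm s (\<lambda>k. y u k - y t k)) \<longlongrightarrow> 0) (at t))"

definition has_D_derivative ::
  "real \<Rightarrow> (real \<Rightarrow> nat \<Rightarrow> complex) \<Rightarrow> (real \<Rightarrow> nat \<Rightarrow> complex) \<Rightarrow> bool" where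
  "has_D_derivative s y v \<longleftrightarrow>
     (\<forall>t. y t \<in> D s \<and> v t \<in> D s) \<and>
     (\<forall>t. ((\<lambda>h. Dnorm s (\<lambda>k. (y (t + h) k - y t k) / of_real h - v t k)) \<longlongrightarrow> 0) (at 0))"

text \<open>Two-fold differentiation in \<open>x\<close>, which maps \<open>D\<^sup>s\<close> into \<open>D\<^sup>s\<^sup>-\<^sup>2\<close>.\<close>

definition D_xx :: "(nat \<Rightarrow> complex) \<Rightarrow> (nat \<Rightarrow> complex)" where
  "D_xx c = (\<lambda>k. - (of_nat k)\<^sup>2 * c k)"

text \<open>
  \<open>string_solution \<sigma> y0 y1 y\<close>: the function \<open>y\<close> belongs to
  \<open>C(\<real>, D\<^sup>\<sigma>) \<inter> C\<^sup>1(\<real>, D\<^sup>\<sigma>\<^sup>-\<^sup>1) \<inter> C\<^sup>2(\<real>, D\<^sup>\<sigma>\<^sup>-\<^sup>2)\<close> and solves \<open>y'' - y\<^sub>x\<^sub>x = 0\<close>, \<open>y(0) = y0\<close>,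
  \<open>y'(0) = y1\<close>; here \<open>v\<close> and \<open>w\<close> are \<open>y'\<close> and \<open>y''\<close>. The boundary condition is built into
  the spaces of sine series. For \<open>y0\<close> in \<open>D\<^sup>\<sigma>\<close> and \<open>y1\<close> in \<open>D\<^sup>\<sigma>\<^sup>-\<^sup>1\<close> there is exactly one
  such \<open>y\<close>, see \<open>string_solution_iff\<close>.
\<close>

definition string_solution ::
  "real \<Rightarrow> (nat \<Rightarrow> complex) \<Rightarrow> (nat \<Rightarrow> complex) \<Rightarrow> (real \<Rightarrow> nat \<Rightarrow> complex) \<Rightarrow> bool" where
  "string_solution \<sigma> y0 y1 y \<longleftrightarrow>
     (\<exists>v w. D_continuous \<sigma> y \<and>
            has_D_derivative (\<sigma> - 1) y v \<and> D_continuous (\<sigma> - 1) v \<and>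
            has_D_derivative (\<sigma> - 2) v w \<and> D_continuous (\<sigma> - 2) w \<and>
            (\<forall>t k. w t k - D_xx (y t) k = 0) \<and> y 0 = y0 \<and> v 0 = y1)"


section \<open>The real numbers as a vector space over the rationals\<close>

definition rat_scale :: "rat \<Rightarrow> real \<Rightarrow> real" where
  "rat_scale q x = of_rat q * x"

interpretation rat_real: vector_space rat_scale
  by unfold_locales (simp_all add: rat_scale_def algebra_simps of_rat_add of_rat_mult)

text \<open>
  The condition \<open>rat_real.dim K = n\<close> with \<open>n > 0\<close> excludes infinite dimension, which
  \<open>rat_real.dim\<close> maps to \<open>0\<close>.
\<close>

definition real_algebraic_extension :: "nat \<Rightarrow> real set \<Rightarrow> bool" where
  "real_algebraic_extension n K \<longleftrightarrow>
     n > 0 \<and> \<rat> \<subseteq> K \<and>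
     (\<forall>x\<in>K. \<forall>y\<in>K. x + y \<in> K \<and> x * y \<in> K) \<and>
     (\<forall>x\<in>K. - x \<in> K \<and> inverse x \<in> K) \<and>
     rat_real.dim K = n"


section \<open>Checks of the definitions\<close>

text \<open>
  \<open>D s\<close> is the completion of \<open>sine_poly\<close>, and the solutions of the string
  equation are the series \<open>\<Sum>k\<ge>1. (a k * exp (i k t) + b k * exp (- i k t)) * sin (k x)\<close>.
\<close>

lemma powr_double: "real k powr (2 * s) = (real k powr s)\<^sup>2"
  using powr_add[of "real k" s s] by (simp only: power2_eq_square mult_2)

lemma D_finite_sum_le:
  assumes "c \<in> D s" "finite F" "F \<subseteq> {1..}"
  shows "(\<Sum>k\<in>F. real k powr (2 * s) * (cmod (c k))\<^sup>2) \<le> (Dnorm s c)\<^sup>2"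
proof -
  have "(\<Sum>k\<in>F. real k powr (2 * s) * (cmod (c k))\<^sup>2)
      \<le> (\<Sum>\<^sub>\<infinity>k\<in>{1..}. real k powr (2 * s) * (cmod (c k))\<^sup>2)"
    using assms by (intro finite_sum_le_infsum) (auto simp: D_def)
  also have "\<dots> = (Dnorm s c)\<^sup>2"
    by (simp add: Dnorm_def infsum_nonneg)
  finally show ?thesis .
qed

lemma D_bounded:
  assumes "c 0 = 0" "B \<ge> 0"
    and "\<And>F. finite F \<Longrightarrow> F \<subseteq> {1..} \<Longrightarrow> (\<Sum>k\<in>F. real k powr (2 * s) * (cmod (c k))\<^sup>2) \<le> B\<^sup>2"
  shows "c \<in> D s" "Dnorm s c \<le> B"
proof -
  have sm: "(\<lambda>k. real k powr (2 * s) * (cmod (c k))\<^sup>2) summable_on {1..}"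
    using assms(3) by (intro nonneg_bdd_above_summable_on) (auto intro!: bdd_aboveI2)
  then show "c \<in> D s" using assms(1) by (simp add: D_def)
  have "(\<Sum>\<^sub>\<infinity>k\<in>{1..}. real k powr (2 * s) * (cmod (c k))\<^sup>2) \<le> B\<^sup>2"
    using assms(3) by (intro infsum_le_finite_sums[OF sm]) auto
  then show "Dnorm s c \<le> B" unfolding Dnorm_def
    using assms(2) by (simp add: real_le_lsqrt)
qed

lemma Dnorm_nonneg: "Dnorm s c \<ge> 0"
  by (simp add: Dnorm_def infsum_nonneg)

lemma D_mono:
  assumes "m \<in> D s" "c 0 = 0" "\<And>k. k \<ge> 1 \<Longrightarrow> cmod (c k) \<le> cmod (m k)"
  shows "c \<in> D s" "Dnorm s c \<le> Dnorm s m"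
proof -
  have "(\<Sum>k\<in>F. real k powr (2 * s) * (cmod (c k))\<^sup>2) \<le> (Dnorm s m)\<^sup>2"
    if F: "finite F" "F \<subseteq> {1..}" for F
  proof -
    have "(\<Sum>k\<in>F. real k powr (2 * s) * (cmod (c k))\<^sup>2)
        \<le> (\<Sum>k\<in>F. real k powr (2 * s) * (cmod (m k))\<^sup>2)"
      using F assms(3) by (intro sum_mono mult_left_mono power_mono) auto
    also have "\<dots> \<le> (Dnorm s m)\<^sup>2" by (rule D_finite_sum_le) (use assms F in auto)
    finally show ?thesis .
  qed
  then show "c \<in> D s" "Dnorm s c \<le> Dnorm s m"
    using D_bounded[of c "Dnorm s m" s] assms(2) Dnorm_nonneg by auto
qed

lemma D_add:
  assumes "a \<in> D s" "b \<in> D s"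
  shows "(\<lambda>k. a k + b k) \<in> D s" "Dnorm s (\<lambda>k. a k + b k) \<le> Dnorm s a + Dnorm s b"
proof -
  have L2: "(\<Sum>k\<in>F. real k powr (2 * s) * (cmod (c k))\<^sup>2) = (L2_set (\<lambda>k. real k powr s * cmod (c k)) F)\<^sup>2"
    for F c
  proof -
    have "(\<Sum>k\<in>F. real k powr (2 * s) * (cmod (c k))\<^sup>2) = (\<Sum>k\<in>F. (real k powr s * cmod (c k))\<^sup>2)"
      by (simp only: power_mult_distrib powr_double)
    then show ?thesis unfolding L2_set_def by (simp only: real_sqrt_pow2 sum_nonneg zero_le_power2)
  qed
  have "(\<Sum>k\<in>F. real k powr (2 * s) * (cmod (a k + b k))\<^sup>2) \<le> (Dnorm s a + Dnorm s b)\<^sup>2"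
    if F: "finite F" "F \<subseteq> {1..}" for F
  proof -
    have "L2_set (\<lambda>k. real k powr s * cmod (a k + b k)) F
        \<le> L2_set (\<lambda>k. real k powr s * cmod (a k) + real k powr s * cmod (b k)) F"
      by (rule L2_set_mono) (simp_all add: norm_triangle_ineq mult_left_mono flip: distrib_left)
    also have "\<dots> \<le> L2_set (\<lambda>k. real k powr s * cmod (a k)) F + L2_set (\<lambda>k. real k powr s * cmod (b k)) F"
      by (rule L2_set_triangle_ineq)
    also have "\<dots> \<le> Dnorm s a + Dnorm s b"
      by (rule add_mono[OF power2_le_imp_le power2_le_imp_le])
        (use D_finite_sum_le[OF assms(1) F] D_finite_sum_le[OF assms(2) F] in \<open>simp_all only: L2 Dnorm_nonneg\<close>)
    finally show ?thesis unfolding L2 by (intro power_mono) (auto simp: L2_set_nonneg)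
  qed
  then show "(\<lambda>k. a k + b k) \<in> D s" "Dnorm s (\<lambda>k. a k + b k) \<le> Dnorm s a + Dnorm s b"
    using D_bounded[of "\<lambda>k. a k + b k" "Dnorm s a + Dnorm s b" s] assms Dnorm_nonneg
    by (auto simp: D_def)
qed

lemma D_uminus:
  assumes "a \<in> D s" shows "(\<lambda>k. - a k) \<in> D s" "Dnorm s (\<lambda>k. - a k) = Dnorm s a"
  using assms by (auto simp: D_def Dnorm_def)

lemma D_diff:
  assumes "a \<in> D s" "b \<in> D s"
  shows "(\<lambda>k. a k - b k) \<in> D s" "Dnorm s (\<lambda>k. a k - b k) \<le> Dnorm s a + Dnorm s b"
  using D_add[OF assms(1) D_uminus(1)[OF assms(2)]] D_uminus(2)[OF assms(2)] by auto

lemma D_cmult: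
  assumes "a \<in> D s" shows "(\<lambda>k. z * a k) \<in> D s"
proof -
  have "(\<lambda>k. (cmod z)\<^sup>2 * (real k powr (2 * s) * (cmod (a k))\<^sup>2)) summable_on {1..}"
    using assms by (intro summable_on_cmult_right) (auto simp: D_def)
  then show ?thesis using assms
    by (auto simp: D_def norm_mult power_mult_distrib mult_ac)
qed

lemma D_component_le:
  assumes "c \<in> D s" "k \<ge> 1"
  shows "cmod (c k) \<le> Dnorm s c / real k powr s"
proof -
  have "(real k powr s * cmod (c k))\<^sup>2 \<le> (Dnorm s c)\<^sup>2"
    using D_finite_sum_le[OF assms(1), of "{k}"] assms(2)
    unfolding power_mult_distrib powr_double by simp
  then have "real k powr s * cmod (c k) \<le> Dnorm s c"
    by (rule power2_le_imp_le) (rule Dnorm_nonneg)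
  then show ?thesis using assms(2) by (simp add: field_simps)
qed

lemma sine_poly_subset_D: "sine_poly \<subseteq> D s"
proof
  fix c assume c: "c \<in> sine_poly"
  have "(\<lambda>k. real k powr (2 * s) * (cmod (c k))\<^sup>2) summable_on {1..}"
    by (rule finite_nonzero_values_imp_summable_on, rule finite_subset[of _ "{k. c k \<noteq> 0}"])
      (use c in \<open>auto simp: sine_poly_def\<close>)
  then show "c \<in> D s" using c by (simp add: D_def sine_poly_def)
qed

lemma D_tail:
  assumes "m \<in> D s" "e > 0"
  obtains F where "finite F" "F \<subseteq> {1..}"
    "Dnorm s (\<lambda>k. if k \<in> F then 0 else m k) < e"
proof -
  let ?f = "\<lambda>k. real k powr (2 * s) * (cmod (m k))\<^sup>2"
  have sm: "?f summable_on {1..}" using assms by (simp add: D_def)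
  obtain F where F: "finite F" "F \<subseteq> {1..}" "dist (sum ?f F) (infsum ?f {1..}) \<le> e\<^sup>2 / 2"
    using infsum_finite_approximation[OF sm, of "e\<^sup>2 / 2"] assms(2) by auto
  have "(\<Sum>\<^sub>\<infinity>k\<in>{1..}. real k powr (2 * s) * (cmod (if k \<in> F then 0 else m k))\<^sup>2)
      = infsum ?f ({1..} - F)"
    by (rule infsum_cong_neutral) auto
  also have "\<dots> = infsum ?f {1..} - sum ?f F"
    using infsum_Diff[OF sm summable_on_finite[OF F(1)] F(2)] F(1) by simp
  also have "\<dots> < e\<^sup>2" using F(3) zero_less_power[OF assms(2), of 2] unfolding dist_real_def by linarith
  finally have "Dnorm s (\<lambda>k. if k \<in> F then 0 else m k) < e"
    unfolding Dnorm_def using assms(2) by (simp add: real_less_lsqrt)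
  with F that show ?thesis by blast
qed

lemma sine_poly_dense:
  assumes "c \<in> D s" "e > 0"
  shows "\<exists>p\<in>sine_poly. Dnorm s (\<lambda>k. c k - p k) < e"
proof -
  obtain F where F: "finite F" "F \<subseteq> {1..}" "Dnorm s (\<lambda>k. if k \<in> F then 0 else c k) < e"
    using D_tail[OF assms] .
  let ?p = "\<lambda>k. if k \<in> F then c k else 0"
  have "?p \<in> sine_poly"
    using F assms(1) by (auto simp: sine_poly_def D_def)
  moreover have "(\<lambda>k. c k - ?p k) = (\<lambda>k. if k \<in> F then 0 else c k)" by auto
  ultimately show ?thesis using F(3) by metis
qed

lemma D_complete:
  assumes "\<And>n::nat. u n \<in> D s"
    and "\<And>e. e > 0 \<Longrightarrow> \<exists>N. \<forall>m\<ge>N. \<forall>n\<ge>N. Dnorm s (\<lambda>k. u m k - u n k) < e"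
  shows "\<exists>c\<in>D s. (\<lambda>n. Dnorm s (\<lambda>k. u n k - c k)) \<longlonglongrightarrow> 0"
proof -
  have "\<exists>l. (\<lambda>n. u n k) \<longlonglongrightarrow> l" if k: "k \<ge> 1" for k
  proof -
    have "Cauchy (\<lambda>n. u n k)"
    proof (rule CauchyI)
      fix e :: real assume e: "0 < e"
      then obtain N where N: "\<forall>m\<ge>N. \<forall>n\<ge>N. Dnorm s (\<lambda>k. u m k - u n k) < e * real k powr s"
        using assms(2)[of "e * real k powr s"] k by auto
      have "cmod (u m k - u n k) < e" if "m \<ge> N" "n \<ge> N" for m n
      proof -
        have "cmod (u m k - u n k) \<le> Dnorm s (\<lambda>k. u m k - u n k) / real k powr s"
          using D_component_le[OF D_diff(1)[OF assms(1) assms(1)] k] .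
        also have "\<dots> < e" using N that k by (simp add: field_simps)
        finally show ?thesis .
      qed
      then show "\<exists>M. \<forall>m\<ge>M. \<forall>n\<ge>M. cmod (u m k - u n k) < e" by blast
    qed
    then show ?thesis by (simp add: Cauchy_convergent_iff convergent_def)
  qed
  then obtain l where l: "\<And>k. k \<ge> 1 \<Longrightarrow> (\<lambda>n. u n k) \<longlonglongrightarrow> l k" by metis
  define c where "c = (\<lambda>k. if k = 0 then 0 else l k)"
  have c: "(\<lambda>n. u n k) \<longlonglongrightarrow> c k" if "k \<ge> 1" for k using l[OF that] that by (simp add: c_def)
  have key: "\<exists>N. \<forall>n\<ge>N. (\<lambda>k. u n k - c k) \<in> D s \<and> Dnorm s (\<lambda>k. u n k - c k) \<le> e"
    if e: "e > 0" for e
  proof -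
    obtain N where N: "\<forall>m\<ge>N. \<forall>n\<ge>N. Dnorm s (\<lambda>k. u m k - u n k) < e"
      using assms(2)[OF e] by blast
    have "(\<lambda>k. u n k - c k) \<in> D s \<and> Dnorm s (\<lambda>k. u n k - c k) \<le> e" if n: "n \<ge> N" for n
    proof -
      have "(\<Sum>k\<in>F. real k powr (2 * s) * (cmod (u n k - c k))\<^sup>2) \<le> e\<^sup>2"
        if F: "finite F" "F \<subseteq> {1..}" for F
      proof (rule LIMSEQ_le_const2)
        show "(\<lambda>m. \<Sum>k\<in>F. real k powr (2 * s) * (cmod (u n k - u m k))\<^sup>2)
            \<longlonglongrightarrow> (\<Sum>k\<in>F. real k powr (2 * s) * (cmod (u n k - c k))\<^sup>2)"
          using F by (intro tendsto_intros c) auto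
        have "(\<Sum>k\<in>F. real k powr (2 * s) * (cmod (u n k - u m k))\<^sup>2) \<le> e\<^sup>2" if "m \<ge> N" for m
        proof -
          have "(\<Sum>k\<in>F. real k powr (2 * s) * (cmod (u n k - u m k))\<^sup>2)
              \<le> (Dnorm s (\<lambda>k. u n k - u m k))\<^sup>2"
            by (rule D_finite_sum_le[OF D_diff(1)[OF assms(1) assms(1)] F])
          also have "\<dots> \<le> e\<^sup>2" using N n that by (intro power_mono) (auto simp: less_imp_le Dnorm_nonneg)
          finally show ?thesis .
        qed
        then show "\<exists>M. \<forall>m\<ge>M. (\<Sum>k\<in>F. real k powr (2 * s) * (cmod (u n k - u m k))\<^sup>2) \<le> e\<^sup>2"
          by blast
      qed
      moreover have "u n 0 - c 0 = 0" using assms(1)[of n] by (simp add: D_def c_def)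
      ultimately show ?thesis using D_bounded[of "\<lambda>k. u n k - c k" e s] e by auto
    qed
    then show ?thesis by blast
  qed
  obtain N where "(\<lambda>k. u N k - c k) \<in> D s" using key[of 1] by auto
  from D_diff(1)[OF assms(1)[of N] this] have "c \<in> D s" by simp
  moreover have "(\<lambda>n. Dnorm s (\<lambda>k. u n k - c k)) \<longlonglongrightarrow> 0"
  proof (rule LIMSEQ_I)
    fix e :: real assume "0 < e"
    then obtain N where "\<forall>n\<ge>N. Dnorm s (\<lambda>k. u n k - c k) \<le> e / 2"
      using key[of "e / 2"] by auto
    then show "\<exists>no. \<forall>n\<ge>no. norm (Dnorm s (\<lambda>k. u n k - c k) - 0) < e"
      using \<open>0 < e\<close> by (intro exI[of _ N]) (force simp: Dnorm_nonneg)
  qed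
  ultimately show ?thesis by blast
qed

lemma sine_coeffs_unique:
  assumes "c \<in> sine_poly"
    and "\<And>x::real. 0 < x \<Longrightarrow> x < pi \<Longrightarrow> (\<Sum>k | c k \<noteq> 0. c k * of_real (sin (real k * x))) = 0"
  shows "c = (\<lambda>_. 0)"
proof -
  have fin: "finite {k. c k \<noteq> 0}" using assms(1) by (simp add: sine_poly_def)
  then obtain N where N: "\<And>k. c k \<noteq> 0 \<Longrightarrow> k \<le> N"
    using finite_nat_set_iff_bounded_le[of "{k. c k \<noteq> 0}"] by auto
  define P where "P = (\<Sum>k\<le>N. monom (c k) (N + k) - monom (c k) (N - k))"
  have root: "poly P (cis x) = 0" if x: "0 < x" "x < pi" for x
  proof -
    have "poly P (cis x) = (\<Sum>k\<le>N. c k * (cis x ^ (N + k) - cis x ^ (N - k)))"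
      by (simp add: P_def poly_sum poly_monom algebra_simps)
    also have "\<dots> = (\<Sum>k\<le>N. 2 * \<i> * cis x ^ N * (c k * of_real (sin (real k * x))))"
    proof (rule sum.cong[OF refl])
      fix k assume "k \<in> {..N}"
      then have e: "cis x ^ (N + k) - cis x ^ (N - k) = cis x ^ N * (cis (real k * x) - cis (- (real k * x)))"
        by (simp add: Complex.DeMoivre cis_mult of_nat_diff algebra_simps)
      have "cis (real k * x) - cis (- (real k * x)) = 2 * \<i> * of_real (sin (real k * x))"
        by (simp add: complex_eq_iff)
      with e show "c k * (cis x ^ (N + k) - cis x ^ (N - k)) = 2 * \<i> * cis x ^ N * (c k * of_real (sin (real k * x)))"
        by simp
    qed
    also have "\<dots> = 2 * \<i> * cis x ^ N * (\<Sum>k\<le>N. c k * of_real (sin (real k * x)))"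
      by (simp add: sum_distrib_left)
    also have "(\<Sum>k\<le>N. c k * of_real (sin (real k * x))) = (\<Sum>k | c k \<noteq> 0. c k * of_real (sin (real k * x)))"
      using N by (intro sum.mono_neutral_right) auto
    finally show ?thesis using assms(2)[OF x] by simp
  qed
  have inj: "inj_on cis {0<..<pi}"
  proof (rule inj_onI)
    fix x y assume "x \<in> {0<..<pi}" "y \<in> {0<..<pi}" "cis x = cis y"
    then show "x = y" using cos_inj_pi[of x y] by (auto simp: complex_eq_iff)
  qed
  have "infinite (cis ` {0<..<pi})"
    using inj by (simp add: finite_image_iff)
  then have "infinite {z. poly P z = 0}"
    by (rule contrapos_nn) (rule finite_subset[rotated], assumption, use root in auto)
  then have P0: "P = 0" using poly_roots_finite by blast
  show ?thesis
  proof
    fix m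
    show "c m = 0"
    proof (cases "m = 0 \<or> m > N")
      case True then show ?thesis using N[of m] assms(1) unfolding sine_poly_def by fastforce
    next
      case False
      then have m: "m \<noteq> 0" "m \<le> N" by auto
      have "coeff P (N + m) = (\<Sum>k\<le>N. if m = k then c k else 0)"
        unfolding P_def coeff_sum using m by (intro sum.cong) auto
      also have "\<dots> = c m" using m by simp
      finally show ?thesis using P0 by simp
    qed
  qed
qed

lemma Dnorm_dominated:
  assumes "m \<in> D s" "\<And>k. k \<ge> 1 \<Longrightarrow> ((\<lambda>h. g h k) \<longlongrightarrow> 0) (at x)"
    and "\<And>h. g h 0 = 0" "\<And>h k. k \<ge> 1 \<Longrightarrow> cmod (g h k) \<le> cmod (m k)"
  shows "((\<lambda>h::real. Dnorm s (g h)) \<longlongrightarrow> 0) (at x)"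
proof (rule tendstoI)
  fix e :: real assume e: "e > 0"
  then obtain F where F: "finite F" "F \<subseteq> {1..}"
      "Dnorm s (\<lambda>k. if k \<in> F then 0 else m k) < e / 2"
    using D_tail[OF assms(1), of "e / 2"] by auto
  have fs: "Dnorm s (\<lambda>k. if k \<in> F then g h k else 0)
      = sqrt (\<Sum>k\<in>F. real k powr (2 * s) * (cmod (g h k))\<^sup>2)" for h
  proof -
    have "(\<Sum>\<^sub>\<infinity>k\<in>{1..}. real k powr (2 * s) * (cmod (if k \<in> F then g h k else 0))\<^sup>2)
        = (\<Sum>\<^sub>\<infinity>k\<in>F. real k powr (2 * s) * (cmod (g h k))\<^sup>2)"
      using F(2) by (intro infsum_cong_neutral) auto
    then show ?thesis using F(1) by (simp add: Dnorm_def)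
  qed
  have "((\<lambda>h. sqrt (\<Sum>k\<in>F. real k powr (2 * s) * (cmod (g h k))\<^sup>2))
      \<longlongrightarrow> sqrt (\<Sum>k\<in>F. real k powr (2 * s) * (cmod 0)\<^sup>2)) (at x)"
    using F(2) by (intro tendsto_intros assms(2)) auto
  then have "((\<lambda>h. Dnorm s (\<lambda>k. if k \<in> F then g h k else 0)) \<longlongrightarrow> 0) (at x)"
    by (simp add: fs)
  then have "\<forall>\<^sub>F h in at x. Dnorm s (\<lambda>k. if k \<in> F then g h k else 0) < e / 2"
    using e by (intro order_tendstoD(2)[where y = 0]) auto
  then show "\<forall>\<^sub>F h in at x. dist (Dnorm s (g h)) 0 < e"
  proof eventually_elim
    fix h assume h: "Dnorm s (\<lambda>k. if k \<in> F then g h k else 0) < e / 2"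
    have m0: "m 0 = 0" using assms(1) by (simp add: D_def)
    have mF: "(\<lambda>k. if k \<in> F then 0 else m k) \<in> D s"
      by (rule D_mono(1)[OF assms(1)]) (use m0 in auto)
    have 1: "(\<lambda>k. if k \<in> F then g h k else 0) \<in> D s"
      by (rule D_mono(1)[OF assms(1)]) (use assms in auto)
    have 2: "(\<lambda>k. if k \<in> F then 0 else g h k) \<in> D s"
      by (rule D_mono(1)[OF assms(1)]) (use assms in auto)
    have 3: "Dnorm s (\<lambda>k. if k \<in> F then 0 else g h k) \<le> Dnorm s (\<lambda>k. if k \<in> F then 0 else m k)"
      by (rule D_mono(2)[OF mF]) (use assms in auto)
    have "g h = (\<lambda>k. (if k \<in> F then g h k else 0) + (if k \<in> F then 0 else g h k))" by auto
    then have "Dnorm s (g h) \<le> Dnorm s (\<lambda>k. if k \<in> F then g h k else 0) + Dnorm s (\<lambda>k. if k \<in> F then 0 else g h k)"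
      using D_add(2)[OF 1 2] by simp
    then show "dist (Dnorm s (g h)) 0 < e" using h 3 F(3) Dnorm_nonneg[of s "g h"]
      by (simp add: dist_real_def)
  qed
qed

lemma powr_shift:
  assumes "k \<ge> 1"
  shows "real k powr (2 * s) = real k powr (2 * (s - 1)) * (real k)\<^sup>2"
proof -
  have "real k powr (2 * (s - 1)) * (real k)\<^sup>2 = real k powr (2 * (s - 1) + 2)"
    unfolding powr_add using assms by simp
  then show ?thesis by (simp add: algebra_simps)
qed

lemma D_mult_k:
  assumes "m \<in> D s" shows "(\<lambda>k. of_nat k * m k) \<in> D (s - 1)"
proof -
  have "(\<lambda>k. real k powr (2 * (s - 1)) * (cmod (of_nat k * m k))\<^sup>2) summable_on {1..}
      \<longleftrightarrow> (\<lambda>k. real k powr (2 * s) * (cmod (m k))\<^sup>2) summable_on {1..}"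
  proof (rule summable_on_cong)
    fix k :: nat assume "k \<in> {1..}"
    then show "real k powr (2 * (s - 1)) * (cmod (of_nat k * m k))\<^sup>2 = real k powr (2 * s) * (cmod (m k))\<^sup>2"
      using powr_shift[of k s] by (simp only: norm_mult power_mult_distrib norm_of_nat atLeast_iff mult.assoc)
  qed
  then show ?thesis using assms by (simp add: D_def)
qed

lemma D_div_k:
  assumes "m \<in> D (s - 1)" shows "(\<lambda>k. m k / of_nat k) \<in> D s"
proof -
  have "(\<lambda>k. real k powr (2 * s) * (cmod (m k / of_nat k))\<^sup>2) summable_on {1..}
      \<longleftrightarrow> (\<lambda>k. real k powr (2 * (s - 1)) * (cmod (m k))\<^sup>2) summable_on {1..}"
  proof (rule summable_on_cong)
    fix k :: nat assume "k \<in> {1..}"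
    then show "real k powr (2 * s) * (cmod (m k / of_nat k))\<^sup>2 = real k powr (2 * (s - 1)) * (cmod (m k))\<^sup>2"
      using powr_shift[of k s] by (simp only: norm_divide power_divide norm_of_nat atLeast_iff) simp
  qed
  then show ?thesis using assms by (simp add: D_def)
qed

lemma has_vector_derivative_lim:
  fixes f :: "real \<Rightarrow> complex"
  shows "(f has_vector_derivative d) (at t) \<longleftrightarrow> ((\<lambda>h. (f (t + h) - f t) / of_real h - d) \<longlongrightarrow> 0) (at 0)"
proof -
  have "norm (f (t + h) - f t - h *\<^sub>R d) / norm h = norm ((f (t + h) - f t) / of_real h - d)"
    if "h \<noteq> 0" for h
  proof -
    have "f (t + h) - f t - h *\<^sub>R d = of_real h * ((f (t + h) - f t) / of_real h - d)"
      using that by (simp add: field_simps scaleR_conv_of_real)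
    then show ?thesis using that by (simp add: norm_mult)
  qed
  then have "((\<lambda>h. norm (f (t + h) - f t - h *\<^sub>R d) / norm h) \<longlongrightarrow> 0) (at 0) \<longleftrightarrow>
      ((\<lambda>h. norm ((f (t + h) - f t) / of_real h - d)) \<longlongrightarrow> 0) (at 0)"
    by (intro filterlim_cong refl) (auto simp: eventually_at_filter)
  then show ?thesis
    by (simp add: has_vector_derivative_def has_derivative_at bounded_linear_scaleR_left tendsto_norm_zero_iff)
qed

definition wave :: "(nat \<Rightarrow> complex) \<Rightarrow> (nat \<Rightarrow> complex) \<Rightarrow> real \<Rightarrow> nat \<Rightarrow> complex" where
  "wave a b t k = (if k = 0 then 0
     else a k * exp (\<i> * of_nat k * of_real t) + b k * exp (- (\<i> * of_nat k * of_real t)))"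

lemma wave_bound: "cmod (wave a b t k) \<le> cmod (a k) + cmod (b k)"
proof -
  have e: "cmod (exp (\<i> * of_nat k * of_real t)) = 1" "cmod (exp (- (\<i> * of_nat k * of_real t))) = 1"
    by (simp_all add: norm_exp_eq_Re)
  show ?thesis
    by (auto simp: wave_def intro!: order.trans[OF norm_triangle_ineq]) (simp only: norm_mult e; simp)
qed

lemma wave_deriv:
  "((\<lambda>t. wave a b t k) has_vector_derivative
     wave (\<lambda>k. \<i> * of_nat k * a k) (\<lambda>k. - (\<i> * of_nat k * b k)) t k) (at t)"
  unfolding wave_def
  by (cases "k = 0") (auto intro!: derivative_eq_intros has_vector_derivative_real_field simp: algebra_simps)

lemma D_norm_add:
  assumes "a \<in> D s" "b \<in> D s"
  shows "(\<lambda>k. of_real (cmod (a k) + cmod (b k))) \<in> D s"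
proof -
  have "(\<lambda>k. complex_of_real (cmod (a k))) \<in> D s" "(\<lambda>k. complex_of_real (cmod (b k))) \<in> D s"
    using assms by (auto simp: D_def)
  from D_add(1)[OF this] show ?thesis by simp
qed

lemma wave_in_D: "a \<in> D s \<Longrightarrow> b \<in> D s \<Longrightarrow> wave a b t \<in> D s"
  by (rule D_mono(1)[OF D_norm_add[of a s b]]) (auto simp: wave_def[of _ _ _ 0] simp flip: of_real_add intro: wave_bound)

lemma wave_D_continuous:
  assumes "a \<in> D s" "b \<in> D s" shows "D_continuous s (wave a b)"
  unfolding D_continuous_def
proof (intro conjI allI)
  fix t show "((\<lambda>u. Dnorm s (\<lambda>k. wave a b u k - wave a b t k)) \<longlongrightarrow> 0) (at t)"
  proof (rule Dnorm_dominated[OF D_cmult[OF D_norm_add[OF assms], of 2]])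
    fix k :: nat
    have "isCont (\<lambda>u. wave a b u k) t"
      using wave_deriv has_vector_derivative_continuous by blast
    then show "((\<lambda>u. wave a b u k - wave a b t k) \<longlongrightarrow> 0) (at t)"
      by (simp add: isCont_def LIM_zero_iff)
  next
    fix h k
    have "cmod (wave a b h k - wave a b t k) \<le> 2 * (cmod (a k) + cmod (b k))"
      unfolding mult_2 by (rule order.trans[OF norm_triangle_ineq4 add_mono[OF wave_bound wave_bound]])
    also have "\<dots> = cmod (2 * of_real (cmod (a k) + cmod (b k)))"
      by (simp only: norm_mult norm_of_real) simp
    finally show "cmod (wave a b h k - wave a b t k) \<le> \<dots>" .
  qed (auto simp: wave_def)
qed (use assms wave_in_D in auto)

lemma wave_D_derivative:
  assumes "a \<in> D s" "b \<in> D s"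
    and a': "a' = (\<lambda>k. \<i> * of_nat k * a k)" and b': "b' = (\<lambda>k. - (\<i> * of_nat k * b k))"
  shows "((\<lambda>h. Dnorm (s - 1) (\<lambda>k. (wave a b (t + h) k - wave a b t k) / of_real h - wave a' b' t k)) \<longlongrightarrow> 0) (at 0)"
proof (rule Dnorm_dominated[OF D_cmult[OF D_mult_k[OF D_norm_add[OF assms(1,2)]], of 2]])
  fix k :: nat
  show "((\<lambda>h. (wave a b (t + h) k - wave a b t k) / of_real h - wave a' b' t k) \<longlongrightarrow> 0) (at 0)"
    using wave_deriv[of a b k t] unfolding a' b' has_vector_derivative_lim .
next
  fix h and k :: nat assume k: "k \<ge> 1"
  define B where "B = real k * (cmod (a k) + cmod (b k))"
  have bd: "cmod (wave a' b' u k) \<le> B" for u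
    using wave_bound[of a' b' u k] by (simp add: a' b' B_def norm_mult algebra_simps)
  have B0: "B \<ge> 0" by (simp add: B_def)
  have "cmod (wave a b (t + h) k - wave a b t k) \<le> B * norm (t + h - t)"
  proof (rule differentiable_bound[of UNIV])
    fix u :: real
    show "((\<lambda>t. wave a b t k) has_derivative (\<lambda>h. h *\<^sub>R wave a' b' u k)) (at u within UNIV)"
      using wave_deriv[of a b k u] unfolding a' b' has_vector_derivative_def by simp
    show "onorm (\<lambda>h. h *\<^sub>R wave a' b' u k) \<le> B"
      by (rule onorm_le) (use mult_left_mono[OF bd[of u] abs_ge_zero] in \<open>simp add: mult.commute\<close>)
  qed auto
  then have "cmod ((wave a b (t + h) k - wave a b t k) / of_real h) \<le> B"
    using B0 by (cases "h = 0") (auto simp: norm_divide field_simps)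
  then have "cmod ((wave a b (t + h) k - wave a b t k) / of_real h - wave a' b' t k) \<le> 2 * B"
    using norm_triangle_ineq4[of "(wave a b (t + h) k - wave a b t k) / of_real h" "wave a' b' t k"] bd[of t]
    by linarith
  also have "2 * B = cmod (2 * (of_nat k * of_real (cmod (a k) + cmod (b k))))"
    by (simp only: norm_mult norm_of_real norm_of_nat B_def) simp
  finally show "cmod ((wave a b (t + h) k - wave a b t k) / of_real h - wave a' b' t k) \<le> \<dots>" .
qed (auto simp: wave_def)

lemma has_D_derivative_component:
  assumes "has_D_derivative s y v"
  shows "((\<lambda>t. y t k) has_vector_derivative v t k) (at t)"
proof (cases "k = 0")
  case True
  then have "y u k = 0" "v u k = 0" for u using assms by (auto simp: has_D_derivative_def D_def)
  then show ?thesis by simp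
next
  case False
  define q where "q h k = (y (t + h) k - y t k) / of_real h - v t k" for h k
  have yv: "y u \<in> D s" "v u \<in> D s" for u using assms by (auto simp: has_D_derivative_def)
  have q: "q h \<in> D s" for h
    using D_diff(1)[OF D_cmult[OF D_diff(1)[OF yv(1)[of "t + h"] yv(1)[of t]], of "1 / of_real h"] yv(2)[of t]]
    by (simp add: q_def[abs_def])
  have "((\<lambda>h. Dnorm s (q h)) \<longlongrightarrow> 0) (at 0)"
    using assms by (simp add: has_D_derivative_def q_def[abs_def])
  then have "((\<lambda>h. Dnorm s (q h) / real k powr s) \<longlongrightarrow> 0) (at 0)"
    by (rule tendsto_divide_zero)
  then have "((\<lambda>h. q h k) \<longlongrightarrow> 0) (at 0)"
    by (rule Lim_null_comparison[rotated])
      (use D_component_le[OF q] False in \<open>auto intro!: always_eventually\<close>)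
  then show ?thesis by (simp add: q_def has_vector_derivative_lim)
qed

lemma oscillator_unique:
  fixes f g :: "real \<Rightarrow> complex" and \<omega> :: real
  assumes f: "\<And>t. (f has_vector_derivative g t) (at t)"
    and g: "\<And>t. (g has_vector_derivative - (of_real \<omega>)\<^sup>2 * f t) (at t)"
  shows "g t + \<i> * of_real \<omega> * f t = (g 0 + \<i> * of_real \<omega> * f 0) * exp (\<i> * of_real \<omega> * of_real t)"
proof -
  let ?p = "\<lambda>t. (g t + \<i> * of_real \<omega> * f t) * exp (- (\<i> * of_real \<omega> * of_real t))"
  have "(?p has_vector_derivative 0) (at t within UNIV)" for t
  proof -
    have e: "((\<lambda>t. exp (- (\<i> * of_real \<omega> * of_real t))) has_vector_derivative
        - (\<i> * of_real \<omega>) * exp (- (\<i> * of_real \<omega> * of_real t))) (at t)"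
      by (auto intro!: derivative_eq_intros has_vector_derivative_real_field)
    have "((\<lambda>t. g t + \<i> * of_real \<omega> * f t) has_vector_derivative
        - (of_real \<omega>)\<^sup>2 * f t + \<i> * of_real \<omega> * g t) (at t)"
      by (intro has_vector_derivative_add has_vector_derivative_mult_right f g)
    from has_vector_derivative_mult[OF this e] show ?thesis
      by (rule has_vector_derivative_eq_rhs) (simp add: algebra_simps power2_eq_square)
  qed
  then obtain c where c: "\<And>t. ?p t = c"
    using has_vector_derivative_zero_constant[of UNIV ?p] by auto
  have "g t + \<i> * of_real \<omega> * f t = ?p t * exp (\<i> * of_real \<omega> * of_real t)"
    by (simp add: exp_minus field_simps)
  also have "?p t = ?p 0" using c by metis
  finally show ?thesis by simp
qed

lemma string_solution_iff:
  assumes "y0 \<in> D \<sigma>" "y1 \<in> D (\<sigma> - 1)"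
    and ab: "\<And>k. k \<ge> 1 \<Longrightarrow> y0 k = a k + b k" "\<And>k. k \<ge> 1 \<Longrightarrow> y1 k = \<i> * of_nat k * (a k - b k)"
  shows "string_solution \<sigma> y0 y1 y \<longleftrightarrow> y = wave a b"
proof
  assume "string_solution \<sigma> y0 y1 y"
  then obtain v w where yvw: "D_continuous \<sigma> y" "has_D_derivative (\<sigma> - 1) y v"
      "has_D_derivative (\<sigma> - 2) v w" "\<And>t k. w t k = D_xx (y t) k" "y 0 = y0" "v 0 = y1"
    unfolding string_solution_def by auto
  have "y t k = wave a b t k" for t k
  proof (cases "k = 0")
    case True
    then show ?thesis using yvw(1) by (auto simp: D_continuous_def D_def wave_def)
  next
    case False
    then have k: "k \<ge> 1" by simp
    have f: "((\<lambda>t. y t k) has_vector_derivative v t k) (at t)" for t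
      by (rule has_D_derivative_component[OF yvw(2)])
    have g: "((\<lambda>t. v t k) has_vector_derivative - (of_real \<omega>)\<^sup>2 * y t k) (at t)"
      if "\<omega> = real k \<or> \<omega> = - real k" for t \<omega>
      using has_D_derivative_component[OF yvw(3), of k t] that by (auto simp: yvw(4) D_xx_def)
    define E where "E = exp (\<i> * of_nat k * of_real t)"
    define E' where "E' = exp (- (\<i> * of_nat k * of_real t))"
    have "v t k + \<i> * of_nat k * y t k = (y1 k + \<i> * of_nat k * y0 k) * E"
      using oscillator_unique[of "\<lambda>t. y t k" "\<lambda>t. v t k" "real k" t, OF f g]
      by (simp add: yvw E_def)
    moreover have "v t k - \<i> * of_nat k * y t k = (y1 k - \<i> * of_nat k * y0 k) * E'"
      using oscillator_unique[of "\<lambda>t. y t k" "\<lambda>t. v t k" "- real k" t, OF f g]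
      by (simp add: yvw E'_def)
    ultimately have "2 * \<i> * of_nat k * y t k = 2 * \<i> * of_nat k * (a k * E + b k * E')"
      unfolding ab(1)[OF k] ab(2)[OF k] by algebra
    then show ?thesis using False by (simp add: wave_def E_def E'_def)
  qed
  then show "y = wave a b" by auto
next
  assume y: "y = wave a b"
  define a0 b0 where "a0 = (\<lambda>k. if k = 0 then 0 else a k)" and "b0 = (\<lambda>k. if k = 0 then 0 else b k)"
  have y': "y = wave a0 b0" unfolding y by (auto simp: fun_eq_iff wave_def a0_def b0_def)
  define a1 b1 where "a1 = (\<lambda>k. \<i> * of_nat k * a0 k)" and "b1 = (\<lambda>k. - (\<i> * of_nat k * b0 k))"
  define a2 b2 where "a2 = (\<lambda>k. \<i> * of_nat k * a1 k)" and "b2 = (\<lambda>k. - (\<i> * of_nat k * b1 k))"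
  have z: "y0 0 = 0" "y1 0 = 0" using assms by (auto simp: D_def)
  have half: "(\<lambda>k. (1/2) * y0 k) \<in> D \<sigma>" "(\<lambda>k. (1 / (2 * \<i>)) * (y1 k / of_nat k)) \<in> D \<sigma>"
    by (rule D_cmult[OF assms(1)], rule D_cmult[OF D_div_k[OF assms(2)]])
  have "a0 = (\<lambda>k. (1/2) * y0 k + (1 / (2 * \<i>)) * (y1 k / of_nat k))"
    using ab z by (auto simp: fun_eq_iff a0_def field_simps)
  then have a0: "a0 \<in> D \<sigma>" using D_add(1)[OF half] by simp
  have "b0 = (\<lambda>k. (1/2) * y0 k - (1 / (2 * \<i>)) * (y1 k / of_nat k))"
    using ab z by (auto simp: fun_eq_iff b0_def field_simps)
  then have b0: "b0 \<in> D \<sigma>" using D_diff(1)[OF half] by simp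
  have step: "(\<lambda>k. \<i> * of_nat k * c k) \<in> D (s - 1)" "(\<lambda>k. - (\<i> * of_nat k * c k)) \<in> D (s - 1)"
    if "c \<in> D s" for c s
    using D_cmult[OF D_mult_k[OF that], of \<i>] D_cmult[OF D_mult_k[OF that], of "- \<i>"]
    by (simp_all add: mult.assoc)
  have a1: "a1 \<in> D (\<sigma> - 1)" and b1: "b1 \<in> D (\<sigma> - 1)"
    unfolding a1_def b1_def by (intro step a0 b0)+
  have a2: "a2 \<in> D (\<sigma> - 2)" and b2: "b2 \<in> D (\<sigma> - 2)"
    using step(1)[OF a1] step(2)[OF b1] by (simp_all add: a2_def b2_def)
  have incl: "c \<in> D (s - 1)" if "c \<in> D s" for c s
    by (rule D_mono(1)[OF D_mult_k[OF that]])
      (use that in \<open>auto simp: D_def norm_mult intro!: mult_le_cancel_right1[THEN iffD2]\<close>)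
  have "has_D_derivative (\<sigma> - 1) y (wave a1 b1)"
    unfolding has_D_derivative_def y'
    using wave_D_derivative[OF a0 b0 a1_def b1_def] wave_in_D[OF a0 b0] wave_in_D[OF a1 b1] incl by auto
  moreover have "has_D_derivative (\<sigma> - 2) (wave a1 b1) (wave a2 b2)"
    unfolding has_D_derivative_def
    using wave_D_derivative[OF a1 b1 a2_def b2_def] wave_in_D[OF a1 b1] wave_in_D[OF a2 b2]
      incl[of _ "\<sigma> - 1"] by auto
  moreover have "wave a2 b2 t k - D_xx (y t) k = 0" for t k
    unfolding y' by (auto simp: wave_def D_xx_def a2_def b2_def a1_def b1_def algebra_simps power2_eq_square)
  moreover have "y 0 = y0" "wave a1 b1 0 = y1"
    unfolding y' using ab z by (auto simp: fun_eq_iff wave_def a1_def b1_def a0_def b0_def algebra_simps)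
  moreover note wave_D_continuous[OF a0 b0] wave_D_continuous[OF a1 b1] wave_D_continuous[OF a2 b2]
  ultimately show "string_solution \<sigma> y0 y1 y"
    unfolding string_solution_def y' by blast
qed

end

theory Submission
  imports Defs "Jordan_Normal_Form.Determinant"
begin

text \<open>
  Everything reduces to one Fourier mode. If \<open>u\<close> and \<open>u'\<close> are the \<open>k\<close>-th coefficients of the
  solution at times \<open>t\<close> and \<open>t'\<close>, then \<open>(u, u')\<close> depends linearly on \<open>(a k, b k)\<close>, with determinant
  \<open>2 \<i> sin (k (t - t'))\<close> and entries of modulus one. Hence the data of the mode are recovered with
  a loss of \<open>1 / \<bar>sin (k (t - t'))\<bar>\<close> (\<open>wave_two_times\<close>). For every \<open>k\<close> the best pair of times may be
  used, so the theorem follows (\<open>string_observability\<close>) once the largest of the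
  \<open>\<bar>sin (k \<pi> \<tau>\<^sub>m)\<bar>\<close> is at least a constant times \<open>k powr (- 1 / (n - 1))\<close>.

  As \<open>\<bar>sin (\<pi> x)\<bar>\<close> is comparable to the distance from \<open>x\<close> to the nearest integer, this says
  that \<open>(\<tau>\<^sub>1, \<dots>, \<tau>\<^sub>n\<^sub>-\<^sub>1)\<close> is badly approximable: if \<open>\<bar>p\<^sub>m - k \<tau>\<^sub>m\<bar> \<le> \<epsilon> \<le> 1\<close> for all \<open>m\<close>, then
  \<open>k \<epsilon>\<^sup>n\<^sup>-\<^sup>1\<close> is bounded below (\<open>badly_approximable\<close>). The tuple \<open>e = (1, \<tau>\<^sub>1, \<dots>, \<tau>\<^sub>n\<^sub>-\<^sub>1)\<close> is a basis of
  \<open>K\<close> over the rationals. Let \<open>\<phi>\<close> be the rational linear functional on \<open>K\<close> with \<open>\<phi> 1 = k\<close> and \<open>\<phi> \<tau>\<^sub>m = p\<^sub>m\<close>, and consider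
  the determinant of the matrix \<open>\<phi> (e\<^sub>i e\<^sub>j)\<close>.

  The determinant is not small: it is a rational number whose denominator is bounded in terms of \<open>e\<close>
  alone, and it is not zero, because a kernel vector yields some \<open>x \<noteq> 0\<close> in \<open>K\<close> with \<open>\<phi>\<close> zero
  on \<open>x K = K\<close>, although \<open>\<phi> 1 \<noteq> 0\<close>. The determinant is not large: \<open>\<phi> x\<close> differs from \<open>k x\<close> by
  \<open>O(\<epsilon>)\<close> for every fixed \<open>x\<close>, so the matrix is \<open>O(\<epsilon>)\<close> away from the rank one matrix \<open>k e\<^sub>i e\<^sub>j\<close>.
  Subtracting \<open>e\<^sub>j\<close> times column \<open>0\<close> from column \<open>j\<close> makes \<open>n - 1\<close> columns of size \<open>O(\<epsilon>)\<close> and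
  leaves one of size \<open>O(k)\<close>, whence the bound \<open>O(k \<epsilon>\<^sup>n\<^sup>-\<^sup>1)\<close>.
\<close>

section \<open>Bases and denominators\<close>

text \<open>
  The ambient space, the reals, has infinite dimension over the rationals, so the count is made
  against a basis of \<open>K\<close>: it is finite because its cardinality \<open>n\<close> is positive, and it cannot
  accommodate \<open>n + 1\<close> independent vectors.
\<close>

lemma algebraic_extension_spanned:
  assumes K: "real_algebraic_extension n K"
    and B: "B \<subseteq> K" "rat_real.independent B" "finite B" "card B = n"
  shows "K \<subseteq> rat_real.span B"
proof
  fix x assume x: "x \<in> K"
  obtain B' where B': "B' \<subseteq> K" "K \<subseteq> rat_real.span B'" "card B' = n"
    using rat_real.basis_exists[of K] K unfolding real_algebraic_extension_def by metis
  have fin: "finite B'"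
    using B'(3) K unfolding real_algebraic_extension_def by (intro card_ge_0_finite) simp
  show "x \<in> rat_real.span B"
  proof (rule ccontr)
    assume out: "x \<notin> rat_real.span B"
    then have "x \<notin> B" using rat_real.span_base by blast
    have "card (insert x B) \<le> card B'"
      using rat_real.independent_span_bound[OF fin rat_real.independent_insertI[OF out B(2)]]
        B B' x by blast
    then show False using \<open>x \<notin> B\<close> B B'(3) by simp
  qed
qed

lemma common_denominator:
  assumes "finite (S :: rat set)"
  shows "\<exists>d::int. d > 0 \<and> (\<forall>q\<in>S. of_int d * q \<in> \<int>)"
  using assms
proof induction
  case empty
  show ?case by (intro exI[of _ 1]) simp
next
  case (insert q S)
  then obtain d where d: "d > 0" "\<forall>q\<in>S. of_int d * q \<in> \<int>" by blast
  obtain a b where q: "q = of_int a / of_int b" "b > 0"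
    using quotient_of_unique[of q] Fract_of_int_quotient by metis
  have "of_int b * q = of_int a" using q by simp
  then have "of_int (d * b) * q = of_int (d * a)" by (simp add: mult.assoc)
  then have "of_int (d * b) * q \<in> \<int>" by (simp only: Ints_of_int)
  moreover have "of_int (d * b) * p \<in> \<int>" if "p \<in> S" for p
  proof -
    have "of_int b * (of_int d * p) \<in> \<int>" using d(2) that by (blast intro: Ints_mult[OF Ints_of_int])
    then show ?thesis by (simp add: mult_ac)
  qed
  ultimately show ?case using d(1) q(2) by (intro exI[of _ "d * b"]) auto
qed

section \<open>Determinant estimates\<close>

lemma det_integral:
  assumes "A \<in> carrier_mat n n" "\<And>i j. i < n \<Longrightarrow> j < n \<Longrightarrow> A $$ (i, j) \<in> \<int>"
  shows "det A \<in> (\<int> :: 'a :: comm_ring_1 set)"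
  unfolding det_def'[OF assms(1)]
proof (rule Ints_sum)
  fix p assume "p \<in> {p. p permutes {0..<n}}"
  then have "p i < n" if "i < n" for i using that permutes_in_image[of p "{0..<n}" i] by auto
  then show "signof p * (\<Prod>i = 0..<n. A $$ (i, p i)) \<in> \<int>"
    using assms(2) by (intro Ints_mult Ints_prod) (auto simp: sign_def)
qed

text \<open>
  In the Leibniz formula every product takes exactly one entry from each column.
\<close>

lemma det_column_bound:
  fixes A :: "real mat"
  assumes "A \<in> carrier_mat n n" "\<And>i j. i < n \<Longrightarrow> j < n \<Longrightarrow> \<bar>A $$ (i, j)\<bar> \<le> B j"
  shows "\<bar>det A\<bar> \<le> fact n * (\<Prod>j = 0..<n. B j)"
proof -
  have "\<bar>signof p * (\<Prod>i = 0..<n. A $$ (i, p i))\<bar> \<le> (\<Prod>j = 0..<n. B j)"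
    if p: "p permutes {0..<n}" for p
  proof -
    have pi: "p i < n" if "i < n" for i using that p permutes_in_image[of p "{0..<n}" i] by auto
    have "\<bar>signof p * (\<Prod>i = 0..<n. A $$ (i, p i))\<bar> = (\<Prod>i = 0..<n. \<bar>A $$ (i, p i)\<bar>)"
      by (simp add: abs_mult abs_prod sign_def)
    also have "\<dots> \<le> (\<Prod>i = 0..<n. B (p i))"
      using assms(2) pi by (intro prod_mono) auto
    also have "\<dots> = (\<Prod>j = 0..<n. B j)"
      using prod.permute[OF p, of B] by (simp add: comp_def)
    finally show ?thesis .
  qed
  then have "\<bar>det A\<bar> \<le> (\<Sum>p | p permutes {0..<n}. (\<Prod>j = 0..<n. B j))"
    unfolding det_def'[OF assms(1)] by (intro order.trans[OF sum_abs] sum_mono) auto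
  also have "\<dots> = fact n * (\<Prod>j = 0..<n. B j)"
    using card_permutations[of "{0..<n}" n] by simp
  finally show ?thesis .
qed

section \<open>The determinant attached to an integer vector\<close>

locale real_field_basis =
  fixes n :: nat and K :: "real set" and e :: "nat \<Rightarrow> real"
  assumes extension: "real_algebraic_extension n K"
    and e_0: "e 0 = 1"
    and inj: "inj_on e {..<n}"
    and e_mem: "e ` {..<n} \<subseteq> K"
    and indep: "rat_real.independent (e ` {..<n})"
begin

definition coord :: "real \<Rightarrow> nat \<Rightarrow> rat" where
  "coord x l = rat_real.representation (e ` {..<n}) x (e l)"

text \<open>The rational linear functional on \<open>K\<close> with value \<open>P l\<close> at \<open>e l\<close>, see \<open>functional_basis\<close>.\<close>

definition functional :: "(nat \<Rightarrow> int) \<Rightarrow> real \<Rightarrow> rat" where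
  "functional P x = (\<Sum>l<n. coord x l * of_int (P l))"

lemma n_pos: "n > 0"
  and K_add: "x \<in> K \<Longrightarrow> y \<in> K \<Longrightarrow> x + y \<in> K"
  and K_mult: "x \<in> K \<Longrightarrow> y \<in> K \<Longrightarrow> x * y \<in> K"
  and K_inverse: "x \<in> K \<Longrightarrow> inverse x \<in> K"
  and K_rat: "of_rat q \<in> K"
  using extension unfolding real_algebraic_extension_def by auto

lemma e_in_K: "l < n \<Longrightarrow> e l \<in> K"
  using e_mem by auto

lemma K_sum: "(\<And>i. i \<in> I \<Longrightarrow> f i \<in> K) \<Longrightarrow> sum f I \<in> K"
proof (induction I rule: infinite_finite_induct)
  case (insert i I)
  then show ?case by (simp add: K_add)
qed (use K_rat[of 0] in simp_all)

lemma K_span: "x \<in> K \<Longrightarrow> x \<in> rat_real.span (e ` {..<n})"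
  using algebraic_extension_spanned[OF extension e_mem indep] card_image[OF inj] by auto

lemma coord_expansion: "x \<in> K \<Longrightarrow> (\<Sum>l<n. of_rat (coord x l) * e l) = x"
  using rat_real.sum_representation_eq[OF indep K_span, of x "e ` {..<n}"]
  by (simp add: sum.reindex[OF inj] coord_def rat_scale_def)

lemma coord_sum_scale:
  assumes "\<And>i. i \<in> I \<Longrightarrow> x i \<in> K"
  shows "coord (\<Sum>i\<in>I. of_rat (q i) * x i) l = (\<Sum>i\<in>I. q i * coord (x i) l)"
proof -
  have "of_rat (q i) * x i \<in> rat_real.span (e ` {..<n})" if "i \<in> I" for i
    using assms[OF that] by (intro K_span K_mult K_rat)
  then have "coord (\<Sum>i\<in>I. of_rat (q i) * x i) l = (\<Sum>i\<in>I. coord (of_rat (q i) * x i) l)"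
    by (simp add: coord_def rat_real.representation_sum[OF indep])
  also have "\<dots> = (\<Sum>i\<in>I. q i * coord (x i) l)"
    using rat_real.representation_scale[OF indep K_span] assms
    by (intro sum.cong refl) (simp add: coord_def rat_scale_def)
  finally show ?thesis .
qed

lemma coord_basis: "i < n \<Longrightarrow> l < n \<Longrightarrow> coord (e i) l = (if l = i then 1 else 0)"
  using inj by (auto simp: coord_def rat_real.representation_basis[OF indep] inj_on_eq_iff)

lemma functional_sum_scale:
  assumes "\<And>i. i \<in> I \<Longrightarrow> x i \<in> K"
  shows "functional P (\<Sum>i\<in>I. of_rat (q i) * x i) = (\<Sum>i\<in>I. q i * functional P (x i))"
  unfolding functional_def coord_sum_scale[OF assms, of I "\<lambda>i. i", simplified] sum_distrib_left sum_distrib_right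
  by (subst sum.swap) (simp add: coord_sum_scale assms sum_distrib_right mult_ac)

lemma functional_basis: "i < n \<Longrightarrow> functional P (e i) = of_int (P i)"
  by (simp add: functional_def coord_basis if_distrib[of "\<lambda>c. c * _"] cong: if_cong)

text \<open>
  The Gram matrix, in the basis \<open>e\<close>, of the bilinear form \<open>(x, y) \<mapsto> functional P (x y)\<close>; the trace
  form is the classical instance. As \<open>K\<close> is a field, such a form is nondegenerate unless the
  functional vanishes.
\<close>

definition form_mat :: "(nat \<Rightarrow> int) \<Rightarrow> rat mat" where
  "form_mat P = mat n n (\<lambda>(i, j). functional P (e i * e j))"

lemma form_mat_carrier [simp]: "form_mat P \<in> carrier_mat n n"
  by (simp add: form_mat_def)

text \<open>
  A kernel vector consists of the coordinates of some \<open>x \<noteq> 0\<close> such that the functional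
  annihilates all products \<open>e i * x\<close>, hence \<open>x K\<close>, hence \<open>1 = inverse x * x\<close>. But its value at
  \<open>1 = e 0\<close> is \<open>P 0\<close>.
\<close>

lemma det_form_mat_nonzero:
  assumes "P 0 \<noteq> 0"
  shows "det (form_mat P) \<noteq> 0"
proof
  assume "det (form_mat P) = 0"
  then obtain v where v: "v \<in> carrier_vec n" "v \<noteq> 0\<^sub>v n" "form_mat P *\<^sub>v v = 0\<^sub>v n"
    using det_0_iff_vec_prod_zero_field[OF form_mat_carrier] by blast
  define x where "x = (\<Sum>j<n. of_rat (vec_index v j) * e j)"
  have x: "x \<in> K" unfolding x_def by (intro K_sum K_mult K_rat e_in_K) simp
  have c: "coord x l = vec_index v l" if "l < n" for l
    unfolding x_def using that
    by (subst coord_sum_scale) (auto simp: e_in_K coord_basis if_distrib[of "\<lambda>c. _ * c"] cong: if_cong)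
  obtain l where "l < n" "vec_index v l \<noteq> 0"
    using v(1,2) by (metis carrier_vecD eq_vecI index_zero_vec)
  then have "coord x l \<noteq> 0" using c by simp
  moreover have "coord 0 l = 0" by (simp add: coord_def rat_real.representation_zero)
  ultimately have x0: "x \<noteq> 0" by auto
  have ann: "functional P (e i * x) = 0" if i: "i < n" for i
  proof -
    have "functional P (e i * x) = functional P (\<Sum>j<n. of_rat (vec_index v j) * (e i * e j))"
      by (simp add: x_def sum_distrib_left mult_ac)
    also have "\<dots> = (\<Sum>j<n. vec_index v j * functional P (e i * e j))"
      using i by (intro functional_sum_scale K_mult e_in_K) auto
    also have "\<dots> = vec_index (form_mat P *\<^sub>v v) i"
      using i v(1) by (simp add: form_mat_def scalar_prod_def lessThan_atLeast0 mult.commute)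
    finally show ?thesis using v(3) i by simp
  qed
  have "functional P 1 = functional P (\<Sum>i<n. of_rat (coord (inverse x) i) * (e i * x))"
    using coord_expansion[OF K_inverse[OF x]] x0
    by (simp flip: sum_distrib_right mult.assoc)
  also have "\<dots> = (\<Sum>i<n. coord (inverse x) i * functional P (e i * x))"
    using x by (intro functional_sum_scale K_mult e_in_K) auto
  also have "\<dots> = 0" using ann by simp
  finally show False using functional_basis[of 0 P] n_pos e_0 assms by simp
qed

text \<open>
  The entries of the matrix are integer combinations of the structure constants of the basis. If
  \<open>d\<close> is a common denominator of these, then \<open>d ^ n\<close> times the determinant is a nonzero integer.
\<close>

lemma det_form_mat_lower_bound:
  "\<exists>c::real>0. \<forall>P. P 0 \<noteq> 0 \<longrightarrow> c \<le> \<bar>of_rat (det (form_mat P))\<bar>"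
proof -
  obtain d :: int where d: "d > 0" and
    den: "\<And>i j l. i < n \<Longrightarrow> j < n \<Longrightarrow> l < n \<Longrightarrow> of_int d * coord (e i * e j) l \<in> \<int>"
    using common_denominator[of "(\<lambda>(i, j, l). coord (e i * e j) l) ` ({..<n} \<times> {..<n} \<times> {..<n})"]
    by auto
  have "1 / real_of_int d ^ n \<le> \<bar>of_rat (det (form_mat P))\<bar>" if P: "P 0 \<noteq> 0" for P
  proof -
    define A where "A = of_int d \<cdot>\<^sub>m form_mat P"
    have A: "A \<in> carrier_mat n n" by (simp add: A_def)
    have "A $$ (i, j) \<in> \<int>" if "i < n" "j < n" for i j
    proof -
      have "A $$ (i, j) = (\<Sum>l<n. (of_int d * coord (e i * e j) l) * of_int (P l))"
        using that by (simp add: A_def form_mat_def functional_def sum_distrib_left mult_ac)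
      also have "\<dots> \<in> \<int>" using that by (intro Ints_sum Ints_mult[OF den Ints_of_int]) auto
      finally show ?thesis .
    qed
    then have "det A \<in> \<int>" by (rule det_integral[OF A])
    moreover have detA: "det A = of_int d ^ n * det (form_mat P)"
      using carrier_matD[OF form_mat_carrier] by (simp add: A_def)
    ultimately have "1 \<le> \<bar>det A\<bar>"
      using det_form_mat_nonzero[of P] P d by (intro Ints_nonzero_abs_ge1) auto
    then have "real_of_rat 1 \<le> of_rat \<bar>det A\<bar>" by (simp only: of_rat_less_eq)
    also have "of_rat \<bar>det A\<bar> = \<bar>real_of_rat (det A)\<bar>" by (simp add: abs_if of_rat_minus)
    also have "\<dots> = real_of_int d ^ n * \<bar>of_rat (det (form_mat P))\<bar>"
      using d by (simp add: detA abs_mult of_rat_mult of_rat_power)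
    finally have "1 \<le> real_of_int d ^ n * \<bar>of_rat (det (form_mat P))\<bar>" by simp
    then show ?thesis using d by (simp add: field_simps)
  qed
  then show ?thesis using d by (intro exI[of _ "1 / real_of_int d ^ n"]) auto
qed


text \<open>
  The real functional \<open>x \<mapsto> functional P x - P 0 * x\<close> is small on the basis, so it is small at every
  \<open>x\<close> in proportion to the size of the coordinates of \<open>x\<close>.
\<close>

lemma functional_near_multiple:
  assumes "x \<in> K" "\<And>l. l < n \<Longrightarrow> \<bar>of_int (P l) - of_int (P 0) * e l\<bar> \<le> \<epsilon>"
  shows "\<bar>of_rat (functional P x) - of_int (P 0) * x\<bar> \<le> (\<Sum>l<n. \<bar>of_rat (coord x l)\<bar>) * \<epsilon>"
proof -
  have "of_int (P 0) * x = (\<Sum>l<n. of_rat (coord x l) * (of_int (P 0) * e l))"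
    using arg_cong[OF coord_expansion[OF assms(1)], of "\<lambda>z. of_int (P 0) * z"]
    by (simp add: sum_distrib_left mult_ac)
  then have "of_rat (functional P x) - of_int (P 0) * x
      = (\<Sum>l<n. of_rat (coord x l) * (of_int (P l) - of_int (P 0) * e l))"
    by (simp add: functional_def of_rat_sum of_rat_mult right_diff_distrib sum_subtractf)
  also have "\<bar>\<dots>\<bar> \<le> (\<Sum>l<n. \<bar>of_rat (coord x l)\<bar> * \<epsilon>)"
    using assms(2) by (intro order.trans[OF sum_abs] sum_mono) (auto simp: abs_mult intro: mult_left_mono)
  finally show ?thesis by (simp add: sum_distrib_right)
qed

text \<open>
  The subtraction of \<open>e j\<close> times column \<open>0\<close> from each column \<open>j > 0\<close>, carried out for all \<open>j\<close> at
  once by a unipotent upper triangular factor. The multipliers are irrational, so this takes place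
  over the reals.
\<close>

lemma det_form_mat_column_ops:
  "\<exists>A \<in> carrier_mat n n. det A = real_of_rat (det (form_mat P)) \<and>
     (\<forall>i<n. \<forall>j<n. A $$ (i, j) =
        (if j = 0 then of_int (P i) else of_rat (functional P (e i * e j)) - e j * of_int (P i)))"
proof -
  define R where "R = map_mat real_of_rat (form_mat P)"
  define U where "U = mat n n (\<lambda>(i, j). if i = j then 1 else if i = 0 then - e j else 0)"
  have R: "R \<in> carrier_mat n n" and U: "U \<in> carrier_mat n n" by (simp_all add: R_def U_def)
  have "diag_mat U = replicate n 1"
    by (auto simp: diag_mat_def U_def intro!: nth_equalityI)
  then have "det U = 1"
    using det_upper_triangular[of U n] U by (auto simp: upper_triangular_def U_def)
  then have "det (R * U) = real_of_rat (det (form_mat P))"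
    using det_mult[OF R U] by (simp add: R_def of_rat_hom.hom_det)
  moreover have "(R * U) $$ (i, j) =
      (if j = 0 then of_int (P i) else of_rat (functional P (e i * e j)) - e j * of_int (P i))"
    if i: "i < n" and j: "j < n" for i j
  proof -
    have R0: "R $$ (i, 0) = of_int (P i)"
      using i n_pos by (simp add: R_def form_mat_def e_0 functional_basis)
    have "(R * U) $$ (i, j) = (\<Sum>l<n. R $$ (i, l) * (if l = j then 1 else if l = 0 then - e j else 0))"
      using i j R U by (simp add: scalar_prod_def U_def lessThan_atLeast0)
    also have "\<dots> = (\<Sum>l<n. (if l = j then R $$ (i, j) else 0)
        + (if l = 0 then (if j = 0 then 0 else - e j * R $$ (i, 0)) else 0))"
      by (intro sum.cong) auto
    also have "\<dots> = R $$ (i, j) + (if j = 0 then 0 else - e j * R $$ (i, 0))"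
      using j n_pos by (simp add: sum.distrib)
    finally show ?thesis
      using i j R0 by (simp add: R_def form_mat_def)
  qed
  ultimately show ?thesis using R U by (intro bexI[of _ "R * U"]) auto
qed

text \<open>
  After the column operations the entry at \<open>(i, j)\<close>, \<open>j > 0\<close>, is
  \<open>functional P (e i * e j) - e j * P i\<close>. Both terms are \<open>P 0 * e i * e j + O(\<epsilon>)\<close>, so the
  main parts cancel. Column \<open>0\<close> consists of the \<open>P i\<close>, which are \<open>O(P 0)\<close>.
\<close>

lemma det_form_mat_upper_bound:
  "\<exists>C::real>0. \<forall>P \<epsilon>. P 0 \<ge> 1 \<longrightarrow> \<epsilon> \<le> 1 \<longrightarrow>
     (\<forall>l<n. \<bar>of_int (P l) - of_int (P 0) * e l\<bar> \<le> \<epsilon>) \<longrightarrow>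
     \<bar>of_rat (det (form_mat P))\<bar> \<le> C * of_int (P 0) * \<epsilon> ^ (n - 1)"
proof -
  define W where "W = (\<Sum>i<n. \<Sum>j<n. \<Sum>l<n. \<bar>real_of_rat (coord (e i * e j) l)\<bar>)"
  define E where "E = (\<Sum>l<n. \<bar>e l\<bar>)"
  define C where "C = W + E + 1"
  have W: "(\<Sum>l<n. \<bar>real_of_rat (coord (e i * e j) l)\<bar>) \<le> W" if "i < n" "j < n" for i j
  proof -
    have "(\<Sum>l<n. \<bar>real_of_rat (coord (e i * e j) l)\<bar>)
        \<le> (\<Sum>j<n. \<Sum>l<n. \<bar>real_of_rat (coord (e i * e j) l)\<bar>)"
      using that
      by (intro member_le_sum[of j _ "\<lambda>j. \<Sum>l<n. \<bar>real_of_rat (coord (e i * e j) l)\<bar>"])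
        (auto intro!: sum_nonneg)
    also have "\<dots> \<le> W"
      unfolding W_def using that
      by (intro member_le_sum[of i _ "\<lambda>i. \<Sum>j<n. \<Sum>l<n. \<bar>real_of_rat (coord (e i * e j) l)\<bar>"])
        (auto intro!: sum_nonneg)
    finally show ?thesis .
  qed
  have E: "\<bar>e l\<bar> \<le> E" if "l < n" for l
    unfolding E_def using that by (intro member_le_sum) auto
  have "W \<ge> 0" "E \<ge> 0" unfolding W_def E_def by (intro sum_nonneg; simp)+
  then have C: "C > 0" by (simp add: C_def)
  have "\<bar>of_rat (det (form_mat P))\<bar> \<le> (fact n * C ^ n) * of_int (P 0) * \<epsilon> ^ (n - 1)"
    if P0: "P 0 \<ge> 1" and \<epsilon>: "\<epsilon> \<le> 1" and near: "\<And>l. l < n \<Longrightarrow> \<bar>of_int (P l) - of_int (P 0) * e l\<bar> \<le> \<epsilon>"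
    for P \<epsilon>
  proof -
    have \<epsilon>0: "\<epsilon> \<ge> 0" using near[OF n_pos] by linarith
    obtain A where A: "A \<in> carrier_mat n n" "det A = real_of_rat (det (form_mat P))"
      "\<And>i j. i < n \<Longrightarrow> j < n \<Longrightarrow> A $$ (i, j) =
        (if j = 0 then of_int (P i) else of_rat (functional P (e i * e j)) - e j * of_int (P i))"
      using det_form_mat_column_ops[of P] by blast
    \<comment> \<open>one \<open>C\<close> serves both kinds of columns, so the bounds multiply to \<open>C ^ n\<close> times the main term\<close>
    define B where "B j = (if j = 0 then C * of_int (P 0) else C * \<epsilon>)" for j :: nat
    have "\<bar>A $$ (i, j)\<bar> \<le> B j" if i: "i < n" and j: "j < n" for i j
    proof (cases "j = 0")
      case True
      have "\<bar>of_int (P i)\<bar> \<le> \<bar>of_int (P 0) * e i\<bar> + \<epsilon>" using near[OF i] by linarith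
      also have "\<dots> \<le> of_int (P 0) * E + of_int (P 0) * 1"
        using P0 \<epsilon> E[OF i] by (intro add_mono) (auto simp: abs_mult)
      also have "\<dots> \<le> C * of_int (P 0)"
        using P0 \<open>W \<ge> 0\<close> by (simp add: C_def algebra_simps)
      finally show ?thesis using A(3)[OF i j] True by (simp add: B_def)
    next
      case False
      have "\<bar>e j * (of_int (P i) - of_int (P 0) * e i)\<bar> \<le> E * \<epsilon>"
        unfolding abs_mult using E[OF j] near[OF i] \<open>E \<ge> 0\<close> by (intro mult_mono) auto
      moreover have "\<bar>of_rat (functional P (e i * e j)) - of_int (P 0) * (e i * e j)\<bar> \<le> W * \<epsilon>"
        using functional_near_multiple[OF K_mult[OF e_in_K[OF i] e_in_K[OF j]] near]
          mult_right_mono[OF W[OF i j] \<epsilon>0] by linarith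
      moreover have "A $$ (i, j) = (of_rat (functional P (e i * e j)) - of_int (P 0) * (e i * e j))
          - e j * (of_int (P i) - of_int (P 0) * e i)"
        using A(3)[OF i j] False by (simp add: algebra_simps)
      ultimately have "\<bar>A $$ (i, j)\<bar> \<le> W * \<epsilon> + E * \<epsilon>" by linarith
      then show ?thesis using \<epsilon>0 False by (simp add: B_def C_def algebra_simps)
    qed
    then have "\<bar>det A\<bar> \<le> fact n * (\<Prod>j = 0..<n. B j)" by (rule det_column_bound[OF A(1)])
    also have "(\<Prod>j = 0..<n. B j) = B 0 * (\<Prod>j = 1..<n. B j)"
      using n_pos by (simp add: prod.atLeast_Suc_lessThan)
    also have "(\<Prod>j = 1..<n. B j) = (C * \<epsilon>) ^ (n - 1)"
      by (simp add: B_def)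
    also have "fact n * (B 0 * (C * \<epsilon>) ^ (n - 1)) = (fact n * C ^ n) * of_int (P 0) * \<epsilon> ^ (n - 1)"
      using n_pos by (cases n) (simp_all add: B_def power_mult_distrib)
    finally show ?thesis by (simp add: A(2))
  qed
  then show ?thesis using C by (intro exI[of _ "fact n * C ^ n"]) auto
qed

text \<open>
  The exponent \<open>n - 1\<close> is optimal, by Dirichlet's theorem on simultaneous approximation; hence
  the name.
\<close>

theorem badly_approximable:
  "\<exists>c::real>0. \<forall>P \<epsilon>. P 0 \<ge> 1 \<longrightarrow> \<epsilon> \<le> 1 \<longrightarrow>
     (\<forall>l<n. \<bar>of_int (P l) - of_int (P 0) * e l\<bar> \<le> \<epsilon>) \<longrightarrow> c \<le> of_int (P 0) * \<epsilon> ^ (n - 1)"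
proof -
  obtain c :: real where c: "c > 0" "\<And>P. P 0 \<noteq> 0 \<Longrightarrow> c \<le> \<bar>of_rat (det (form_mat P))\<bar>"
    using det_form_mat_lower_bound by blast
  obtain C :: real where C: "C > 0" and upper: "\<And>P \<epsilon>. P 0 \<ge> 1 \<Longrightarrow> \<epsilon> \<le> 1 \<Longrightarrow>
      (\<forall>l<n. \<bar>of_int (P l) - of_int (P 0) * e l\<bar> \<le> \<epsilon>) \<Longrightarrow>
      \<bar>of_rat (det (form_mat P))\<bar> \<le> C * of_int (P 0) * \<epsilon> ^ (n - 1)"
    using det_form_mat_upper_bound by blast
  have "c / C \<le> of_int (P 0) * \<epsilon> ^ (n - 1)"
    if "P 0 \<ge> 1" "\<epsilon> \<le> 1" "\<forall>l<n. \<bar>of_int (P l) - of_int (P 0) * e l\<bar> \<le> \<epsilon>" for P \<epsilon>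
    using upper[OF that] c(2)[of P] that(1) C by (simp add: field_simps)
  then show ?thesis using c(1) C by (intro exI[of _ "c / C"]) auto
qed

end

section \<open>Sines of multiples\<close>

text \<open>
  Up to sign the sine is unchanged when the nearest multiple of \<open>\<pi>\<close> is subtracted from its
  argument; on \<open>[0, \<pi>/2]\<close> its graph lies above the chord, by concavity.
\<close>

lemma abs_sin_pi_ge: "\<bar>sin (pi * x)\<bar> \<ge> 2 * \<bar>x - of_int (round x)\<bar>"
proof -
  define u where "u = x - of_int (round x)"
  have u: "\<bar>u\<bar> \<le> 1 / 2" unfolding u_def using of_int_round_abs_le[of x] by linarith
  have "sin (pi * \<bar>u\<bar>) \<ge> 0" using u by (intro sin_ge_zero) auto
  have "pi * x = pi * u + pi * of_int (round x)" by (simp add: u_def algebra_simps)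
  then have "sin (pi * x) = sin (pi * u) * cos (pi * of_int (round x))"
    by (simp add: sin_add)
  moreover have "\<bar>cos (pi * of_int (round x))\<bar> = 1"
    by simp
  ultimately have "\<bar>sin (pi * x)\<bar> = \<bar>sin (pi * u)\<bar>" by (simp add: abs_mult)
  also have "\<dots> = sin (pi * \<bar>u\<bar>)"
    using \<open>sin (pi * \<bar>u\<bar>) \<ge> 0\<close> by (cases "u \<ge> 0") (auto simp: abs_if)
  also have "\<dots> \<ge> 2 * \<bar>u\<bar>"
  proof -
    have "concave_on {0..pi / 2} sin"
      by (rule f''_le0_imp_concave[where f' = cos and f'' = "\<lambda>x. - sin x"])
        (auto intro!: derivative_eq_intros sin_ge_zero)
    from concave_onD_Icc'[OF this, of "pi * \<bar>u\<bar>"] u show ?thesis by simp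
  qed
  finally show ?thesis by (simp add: u_def)
qed

text \<open>
  Bad approximability, applied to \<open>P = (k, round (k e\<^sub>1), \<dots>)\<close> and to the largest rounding error.
\<close>

lemma (in real_field_basis) sin_multiples_bound:
  assumes "n \<ge> 2"
  shows "\<exists>c>0. \<forall>k::nat. k \<ge> 1 \<longrightarrow>
    (\<exists>m\<in>{1..n - 1}. c * real k powr (- 1 / (real n - 1)) \<le> \<bar>sin (real k * (pi * e m))\<bar>)"
proof -
  define q where "q = 1 / (real n - 1)"
  have q: "q > 0" "real (n - 1) * q = 1" using assms by (simp_all add: q_def of_nat_diff)
  obtain c :: real where c: "c > 0" and bad: "\<And>P \<epsilon>. P 0 \<ge> 1 \<Longrightarrow> \<epsilon> \<le> 1 \<Longrightarrow>
     (\<And>l. l < n \<Longrightarrow> \<bar>of_int (P l) - of_int (P 0) * e l\<bar> \<le> \<epsilon>) \<Longrightarrow> c \<le> of_int (P 0) * \<epsilon> ^ (n - 1)"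
    using badly_approximable by blast
  have "\<exists>m\<in>{1..n - 1}. c powr q * real k powr (- 1 / (real n - 1)) \<le> \<bar>sin (real k * (pi * e m))\<bar>"
    if k: "k \<ge> 1" for k :: nat
  proof -
    define err where "err m = \<bar>real k * e m - of_int (round (real k * e m))\<bar>" for m
    define \<epsilon> where "\<epsilon> = Max (err ` {1..n - 1})"
    have "\<epsilon> \<in> err ` {1..n - 1}" unfolding \<epsilon>_def using assms by (intro Max_in) auto
    then obtain m where m: "m \<in> {1..n - 1}" "\<epsilon> = err m" by blast
    have \<epsilon>: "0 \<le> \<epsilon>" "\<epsilon> \<le> 1"
      using of_int_round_abs_le[of "real k * e m"] by (simp_all add: m(2) err_def abs_minus_commute)
    define P where "P l = (if l = 0 then int k else round (real k * e l))" for l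
    have "\<bar>of_int (P l) - of_int (P 0) * e l\<bar> \<le> \<epsilon>" if "l < n" for l
    proof (cases "l = 0")
      case False
      then have "err l \<le> \<epsilon>" unfolding \<epsilon>_def using that by (intro Max_ge) auto
      then show ?thesis using False by (simp add: P_def err_def abs_minus_commute)
    qed (use \<epsilon> in \<open>simp add: P_def e_0\<close>)
    then have "c \<le> of_int (P 0) * \<epsilon> ^ (n - 1)" using k \<epsilon> by (intro bad) (auto simp: P_def)
    then have le: "c / real k \<le> \<epsilon> ^ (n - 1)" using k by (simp add: P_def field_simps)
    then have "\<epsilon> ^ (n - 1) > 0" using c k by (intro less_le_trans[OF _ le]) auto
    then have "\<epsilon> > 0" using \<epsilon>(1) assms by (cases "\<epsilon> = 0") (auto simp: power_0_left split: if_splits)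
    have "(c / real k) powr q \<le> (\<epsilon> ^ (n - 1)) powr q"
      using le q c by (intro powr_mono2) auto
    also have "\<dots> = \<epsilon> powr (real (n - 1) * q)"
      by (simp only: powr_realpow[OF \<open>\<epsilon> > 0\<close>, symmetric] powr_powr)
    also have "\<dots> = \<epsilon>"
      unfolding q(2) using \<open>\<epsilon> > 0\<close> by simp
    also have "\<dots> \<le> \<bar>sin (pi * (real k * e m))\<bar>"
      unfolding m(2) err_def by (rule order.trans[OF _ abs_sin_pi_ge]) simp
    finally show ?thesis
      using m(1) c k by (intro bexI[of _ m]) (simp_all add: q_def powr_divide powr_minus field_simps)
  qed
  then show ?thesis using c by (intro exI[of _ "c powr q"]) auto
qed

section \<open>Recovering the data of the string\<close>

text \<open>
  Eliminating \<open>b k\<close>, respectively \<open>a k\<close>, from the two equations for \<open>(a k, b k)\<close> as in Cramer's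
  rule. Each elimination bounds \<open>2 \<bar>sin\<bar>\<close> times one coefficient by the right-hand side, so the
  sum of the two is bounded with factor one.
\<close>

lemma wave_two_times:
  assumes "k \<ge> 1"
  shows "\<bar>sin (real k * (t - t'))\<bar> * (cmod (a k) + cmod (b k))
    \<le> cmod (wave a b t k) + cmod (wave a b t' k)"
proof -
  define u u' where "u = wave a b t k" and "u' = wave a b t' k"
  define x x' where "x = real k * t" and "x' = real k * t'"
  have u: "u = a k * cis x + b k * cis (- x)" "u' = a k * cis x' + b k * cis (- x')"
    using assms by (simp_all add: u_def u'_def x_def x'_def wave_def cis_conv_exp mult_ac)
  have split: "cis (x - x') = cis x * cis (- x')" "cis (x' - x) = cis x' * cis (- x)"
    by (simp_all add: cis_mult)
  have s: "cis (x - x') - cis (x' - x) = 2 * \<i> * of_real (sin (x - x'))"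
    by (simp add: complex_eq_iff sin_diff cos_diff)
  have "u * cis (- x') - u' * cis (- x) = a k * (cis (x - x') - cis (x' - x))"
    unfolding u split by (simp add: algebra_simps)
  then have "cmod (a k) * (2 * \<bar>sin (x - x')\<bar>) = cmod (u * cis (- x') - u' * cis (- x))"
    unfolding s by (simp add: norm_mult)
  then have 1: "cmod (a k) * (2 * \<bar>sin (x - x')\<bar>) \<le> cmod u + cmod u'"
    using norm_triangle_ineq4[of "u * cis (- x')" "u' * cis (- x)"] by (simp add: norm_mult)
  have "u' * cis x - u * cis x' = b k * (cis (x - x') - cis (x' - x))"
    unfolding u split by (simp add: algebra_simps)
  then have "cmod (b k) * (2 * \<bar>sin (x - x')\<bar>) = cmod (u' * cis x - u * cis x')"
    unfolding s by (simp add: norm_mult)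
  then have 2: "cmod (b k) * (2 * \<bar>sin (x - x')\<bar>) \<le> cmod u + cmod u'"
    using norm_triangle_ineq4[of "u' * cis x" "u * cis x'"] by (simp add: norm_mult)
  have "real k * (t - t') = x - x'" by (simp add: x_def x'_def algebra_simps)
  then show ?thesis using 1 2 unfolding u_def u'_def by (simp add: distrib_left mult.commute)
qed

lemma Dnorm_le_weighted:
  assumes "m \<in> D r" "c 0 = 0" "C \<ge> 0"
    and "\<And>k. k \<ge> 1 \<Longrightarrow> real k powr s * cmod (c k) \<le> C * (real k powr r * cmod (m k))"
  shows "Dnorm s c \<le> C * Dnorm r m"
proof (rule D_bounded(2)[where c = c, OF assms(2)])
  fix F :: "nat set" assume F: "finite F" "F \<subseteq> {1..}"
  have "real k powr (2 * s) * (cmod (c k))\<^sup>2 \<le> C\<^sup>2 * (real k powr (2 * r) * (cmod (m k))\<^sup>2)"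
    if "k \<in> F" for k
    using power_mono[OF assms(4), of k 2] F(2) that by (auto simp: powr_double power_mult_distrib)
  then have "(\<Sum>k\<in>F. real k powr (2 * s) * (cmod (c k))\<^sup>2)
      \<le> C\<^sup>2 * (\<Sum>k\<in>F. real k powr (2 * r) * (cmod (m k))\<^sup>2)"
    unfolding sum_distrib_left by (rule sum_mono)
  also have "\<dots> \<le> C\<^sup>2 * (Dnorm r m)\<^sup>2"
    by (intro mult_left_mono D_finite_sum_le assms F) simp
  finally show "(\<Sum>k\<in>F. real k powr (2 * s) * (cmod (c k))\<^sup>2) \<le> (C * Dnorm r m)\<^sup>2"
    by (simp add: power_mult_distrib)
qed (simp add: assms(3) Dnorm_nonneg)

text \<open>
  Since the pair of times that is useful for the mode \<open>k\<close> varies with \<open>k\<close>, the observations are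
  gathered into one sequence that dominates all of them. Its values are cast to complex numbers
  only to make it an element of \<open>D r\<close>.
\<close>

lemma D_sum_norms:
  assumes "finite I" "\<And>i. i \<in> I \<Longrightarrow> f i \<in> D r"
  shows "(\<lambda>k. of_real (\<Sum>i\<in>I. cmod (f i k))) \<in> D r \<and>
    Dnorm r (\<lambda>k. of_real (\<Sum>i\<in>I. cmod (f i k))) \<le> (\<Sum>i\<in>I. Dnorm r (f i))"
  using assms
proof induction
  case empty
  then show ?case by (simp add: D_def Dnorm_def)
next
  case (insert j I)
  have "(\<lambda>k. complex_of_real (cmod (f j k))) \<in> D r"
    "Dnorm r (\<lambda>k. complex_of_real (cmod (f j k))) = Dnorm r (f j)"
    using insert.prems[of j] by (simp_all add: D_def Dnorm_def)
  then show ?case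
    using D_add[of "\<lambda>k. complex_of_real (cmod (f j k))" r "\<lambda>k. of_real (\<Sum>i\<in>I. cmod (f i k))"]
      insert by fastforce
qed

text \<open>
  The separation of the times loses \<open>q\<close> derivatives. The constant \<open>4 / c\<close> collects a factor \<open>2\<close>
  for the two observations used at each mode and another for the two norms on the left. The times
  \<open>i\<close> and \<open>j\<close> may coincide, which is why both are bounded separately by the sum over \<open>I\<close>.
\<close>

lemma string_observability:
  assumes c: "c > 0"
    and sep: "\<And>k. k \<ge> 1 \<Longrightarrow> \<exists>i\<in>I. \<exists>j\<in>I. c * real k powr (- q) \<le> \<bar>sin (real k * (t i - t j))\<bar>"
    and "finite I" "s = r - q"
    and y0: "y0 \<in> D r" and y1: "y1 \<in> D (r - 1)" and sol: "string_solution r y0 y1 y"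
  shows "Dnorm s y0 + Dnorm (s - 1) y1 \<le> 4 / c * (\<Sum>i\<in>I. Dnorm r (y (t i)))"
proof -
  define a b where "a k = (y0 k + y1 k / (\<i> * of_nat k)) / 2"
    and "b k = (y0 k - y1 k / (\<i> * of_nat k)) / 2" for k
  have ab: "y0 k = a k + b k" "y1 k = \<i> * of_nat k * (a k - b k)" if "k \<ge> 1" for k
    using that by (simp_all add: a_def b_def field_simps)
  have y: "y = wave a b"
    using string_solution_iff[OF y0 y1, of a b y] ab sol by blast
  have yD: "y (t i) \<in> D r" for i
    using sol by (auto simp: string_solution_def D_continuous_def)
  define h where "h k = (\<Sum>i\<in>I. cmod (y (t i) k))" for k
  have hD: "(\<lambda>k. of_real (h k)) \<in> D r" and
    hle: "Dnorm r (\<lambda>k. of_real (h k)) \<le> (\<Sum>i\<in>I. Dnorm r (y (t i)))"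
    using D_sum_norms[OF \<open>finite I\<close>, of "\<lambda>i. y (t i)" r] yD by (auto simp: h_def)
  have h_abs: "cmod (of_real (h k)) = h k" for k
    unfolding norm_of_real h_def by (simp add: sum_nonneg)
  have main: "real k powr s * (cmod (a k) + cmod (b k)) \<le> 2 / c * (real k powr r * h k)"
    if k: "k \<ge> 1" for k
  proof -
    obtain i j where ij: "i \<in> I" "j \<in> I" "c * real k powr (- q) \<le> \<bar>sin (real k * (t i - t j))\<bar>"
      using sep[OF k] by blast
    have "c * real k powr (- q) * (cmod (a k) + cmod (b k))
        \<le> \<bar>sin (real k * (t i - t j))\<bar> * (cmod (a k) + cmod (b k))"
      using ij(3) by (intro mult_right_mono) auto
    also have "\<dots> \<le> cmod (y (t i) k) + cmod (y (t j) k)"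
      unfolding y by (rule wave_two_times[OF k])
    also have "\<dots> \<le> h k + h k"
      unfolding h_def using ij \<open>finite I\<close>
      by (intro add_mono member_le_sum[of _ I "\<lambda>i. cmod (y (t i) k)"]) auto
    finally have "real k powr (- q) * (cmod (a k) + cmod (b k)) \<le> 2 / c * h k"
      using c by (simp add: field_simps)
    then have "real k powr r * (real k powr (- q) * (cmod (a k) + cmod (b k))) \<le> real k powr r * (2 / c * h k)"
      by (intro mult_left_mono) auto
    moreover have "real k powr s = real k powr r * real k powr (- q)"
      using \<open>s = r - q\<close> by (simp flip: powr_add)
    ultimately show ?thesis by (simp add: mult_ac)
  qed
  have "Dnorm s y0 \<le> 2 / c * Dnorm r (\<lambda>k. of_real (h k))"
  proof (rule Dnorm_le_weighted[OF hD])
    fix k :: nat assume k: "k \<ge> 1"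
    have "real k powr s * cmod (y0 k) \<le> real k powr s * (cmod (a k) + cmod (b k))"
      unfolding ab(1)[OF k] by (intro mult_left_mono norm_triangle_ineq) simp
    with main[OF k] show "real k powr s * cmod (y0 k) \<le> 2 / c * (real k powr r * cmod (of_real (h k)))"
      unfolding h_abs by linarith
  qed (use c y0 in \<open>auto simp: D_def\<close>)
  moreover have "Dnorm (s - 1) y1 \<le> 2 / c * Dnorm r (\<lambda>k. of_real (h k))"
  proof (rule Dnorm_le_weighted[OF hD])
    fix k :: nat assume k: "k \<ge> 1"
    have "real k powr (s - 1) * cmod (y1 k) = real k powr s * cmod (a k - b k)"
      unfolding ab(2)[OF k] using k by (simp add: norm_mult powr_diff)
    also have "\<dots> \<le> real k powr s * (cmod (a k) + cmod (b k))"
      by (intro mult_left_mono norm_triangle_ineq4) simp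
    finally show "real k powr (s - 1) * cmod (y1 k) \<le> 2 / c * (real k powr r * cmod (of_real (h k)))"
      using main[OF k] unfolding h_abs by linarith
  qed (use c y1 in \<open>auto simp: D_def\<close>)
  ultimately have "Dnorm s y0 + Dnorm (s - 1) y1 \<le> 4 / c * Dnorm r (\<lambda>k. of_real (h k))"
    by simp
  also have "\<dots> \<le> 4 / c * (\<Sum>i\<in>I. Dnorm r (y (t i)))"
    using hle c by (intro mult_left_mono) auto
  finally show ?thesis .
qed

theorem theorem4p1:
  fixes n :: nat and t :: "nat \<Rightarrow> real" and r s :: real
    and K :: "real set" and \<tau> :: "nat \<Rightarrow> real"
  assumes "n \<ge> 2"
    and "s = r - 1 / (real n - 1)"
    and "real_algebraic_extension n K"
    and "\<And>m. m \<in> {1..n - 1} \<Longrightarrow> \<exists>i\<in>{1..n}. \<exists>j\<in>{1..n}. \<tau> m = (t i - t j) / pi"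
    and "\<And>m. m \<in> {1..n - 1} \<Longrightarrow> \<tau> m \<in> K"
    and "inj_on \<tau> {1..n - 1}" and "1 \<notin> \<tau> ` {1..n - 1}"
    and "rat_real.independent (insert 1 (\<tau> ` {1..n - 1}))"
  shows "\<exists>c>0. \<forall>y0\<in>D r. \<forall>y1\<in>D (r - 1). \<forall>y. string_solution r y0 y1 y \<longrightarrow>
           Dnorm s y0 + Dnorm (s - 1) y1 \<le> c * (\<Sum>i = 1..n. Dnorm r (y (t i)))"
proof -
  \<comment> \<open>the independent numbers, completed by \<open>1\<close>, are \<open>n\<close> in number and thus a basis of \<open>K\<close>\<close>
  define e where "e l = (if l = 0 then 1 else \<tau> l)" for l
  have idx: "{..<n} = insert 0 {1..n - 1}" using assms(1) by auto
  have img: "e ` {..<n} = insert 1 (\<tau> ` {1..n - 1})" unfolding idx by (auto simp: e_def)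
  have "1 \<in> K" using assms(3) by (auto simp: real_algebraic_extension_def)
  interpret real_field_basis n K e
  proof
    have "inj_on e {1..n - 1}"
      using assms(6) inj_on_cong[of "{1..n - 1}" e \<tau>] by (simp add: e_def)
    moreover have "e ` {1..n - 1} = \<tau> ` {1..n - 1}" by (intro image_cong) (auto simp: e_def)
    ultimately show "inj_on e {..<n}"
      unfolding idx inj_on_insert using assms(7) by (simp add: e_def)
    show "e ` {..<n} \<subseteq> K" unfolding img using assms(5) \<open>1 \<in> K\<close> by auto
    show "rat_real.independent (e ` {..<n})" unfolding img by (rule assms(8))
  qed (use assms(3) in \<open>auto simp: e_def\<close>)
  obtain c where c: "c > 0" and sin: "\<And>k::nat. k \<ge> 1 \<Longrightarrow>
      \<exists>m\<in>{1..n - 1}. c * real k powr (- 1 / (real n - 1)) \<le> \<bar>sin (real k * (pi * e m))\<bar>"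
    using sin_multiples_bound[OF assms(1)] by blast
  have sep: "\<exists>i\<in>{1..n}. \<exists>j\<in>{1..n}.
      c * real k powr - (1 / (real n - 1)) \<le> \<bar>sin (real k * (t i - t j))\<bar>" if k: "k \<ge> 1" for k
  proof -
    obtain m where m: "m \<in> {1..n - 1}"
      "c * real k powr (- 1 / (real n - 1)) \<le> \<bar>sin (real k * (pi * e m))\<bar>"
      using sin[OF k] by blast
    obtain i j where ij: "i \<in> {1..n}" "j \<in> {1..n}" "\<tau> m = (t i - t j) / pi"
      using assms(4)[OF m(1)] by blast
    have "pi * e m = t i - t j" using m(1) ij(3) by (simp add: e_def)
    then have "c * real k powr - (1 / (real n - 1)) \<le> \<bar>sin (real k * (t i - t j))\<bar>"
      using m(2) by simp
    then show ?thesis using ij(1,2) by blast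
  qed
  show ?thesis
    using string_observability[OF c sep finite_atLeastAtMost assms(2)] c
    by (intro exI[of _ "4 / c"]) auto
qed

end
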